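(* Let $L\colon\mathbb R^n\times\mathbb R^n\to\mathbb R_+$ and $\varphi\colon\mathbb R^n\to\mathbb R_+\cup\{+\infty\}$ satisfy the standing assumptions listed in the context, and let $V$ be the value function and $H$ the Hamiltonian. Let $(t,x)\in\mathrm{dom}(V)$ with $t>0$, and let $y\in W^{1,1}(0,t;\mathbb R^n)$ with $y(0)=x$ be a minimizer of the problem defining $V(t,x)$. Assume that either $\partial_-V(t,x)\neq\emptyset$ or the following condition holds: $$\forall x_0\in\mathbb R^n,\ \exists M>0,\ \exists r>0,\ \forall (\xi,u)\in B(x_0,r)\times B(0,r):\quad L(\xi,u)\le M.$$ Then the set $$\Big\{\frac{y(h)-x}{h} : 0<h\le t\Big\}$$ is bounded in $\mathbb R^n$. Furthermore, if $\frac{y(h_i)-x}{h_i}\to u$ for some sequence $h_i\to0+$ and some $u\in\mathbb R^n$, then $$D_\uparrow V(t,x)(-1,u)\le -L(x,u).$$ Consequently, $V$ is a viscosity supersolution of the Hamilton–Jacobi equation $V_t+H(x,-V_x)=0$, i.e. $$\forall (t,x)\in\mathbb R_+^\star\times\mathbb R^n,\ \forall (p_t,p_x)\in\partial_-V(t,x):\quad p_t+H(x,-p_x)\ge0.$$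
   Context: Notation: $\mathbb R_+=[0,+\infty)$, $\mathbb R_+^\star=(0,+\infty)$; $B(x,r)$ is the closed ball with centre $x$ and radius $r$. Standing assumptions: $L\colon\mathbb R^n\times\mathbb R^n\to\mathbb R_+$ is lower semicontinuous and $L(x,\cdot)$ is convex for every $x$; there is a convex function $\Theta\colon\mathbb R^n\to\mathbb R_+$ with $\lim_{|u|\to\infty}\Theta(u)/|u|=+\infty$ and $L(x,u)\ge\Theta(u)$ for all $(x,u)$; $\varphi\colon\mathbb R^n\to\mathbb R_+\cup\{+\infty\}$ is lower semicontinuous and not identically $+\infty$. Value function: for $(t,x)\in\mathbb R_+\times\mathbb R^n$, $$V(t,x)=\inf\Big\{\int_0^t L(y(s),y'(s))\,ds+\varphi(y(t)) : y\in W^{1,1}(0,t;\mathbb R^n),\ y(0)=x\Big\}.$$ Hamiltonian: $H(x,p)=\sup_{u\in\mathbb R^n}\big(\langle p,u\rangle-L(x,u)\big)$. $\mathrm{dom}(V)$ is the set where $V<+\infty$. For $z=(t,x)\in\mathrm{dom}(V)$ and $(\alpha,u)\in\mathbb R\times\mathbb R^n$, $$D_\uparrow V(t,x)(\alpha,u)=\liminf_{h\to0+,\,(\alpha',v)\to(\alpha,u)}\frac{V(t+h\alpha',x+hv)-V(t,x)}{h},$$ $$\partial_-V(z)=\Big\{p\in\mathbb R\times\mathbb R^n : \liminf_{z'\to z}\frac{V(z')-V(z)-\langle p,z'-z\rangle}{|z'-z|}\ge0\Big\};$$ $\partial_-V(z)=\emptyset$ by convention if $z\notin\mathrm{dom}(V)$.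 *)

theory Defs
  imports "HOL-Analysis.Analysis"
begin

definition lsc :: "('a::topological_space \<Rightarrow> 'b::{complete_linorder, linorder_topology}) \<Rightarrow> bool"
  where "lsc f \<longleftrightarrow> (\<forall>x. f x \<le> Liminf (at x) f)"

text \<open>
  Weak derivatives on the open interval from \<open>0\<close> to \<open>t\<close>, in the sense of distributions, tested
  against \<open>C\<^sup>1\<close> functions with compact support in the interval.
\<close>

definition has_weak_derivative ::
    "real \<Rightarrow> (real \<Rightarrow> real ^ 'n) \<Rightarrow> (real \<Rightarrow> real ^ 'n) \<Rightarrow> bool"
  where "has_weak_derivative t y g \<longleftrightarrow>
    (\<forall>\<psi> :: real \<Rightarrow> real.
       \<psi> C1_differentiable_on UNIV \<and> (\<exists>K. compact K \<and> K \<subseteq> {0<..<t} \<and> (\<forall>s. s \<notin> K \<longrightarrow> \<psi> s = 0)) \<longrightarrow>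
       (LINT s:{0<..<t}|lebesgue. deriv \<psi> s *\<^sub>R y s) =
         - (LINT s:{0<..<t}|lebesgue. \<psi> s *\<^sub>R g s))"

text \<open>
  \<open>W\<^sup>1\<^sup>,\<^sup>1(0,t;\<real>\<^sup>n)\<close>. An element is represented by its continuous representative on the closed
  interval, so that \<open>y 0\<close> and \<open>y t\<close> make sense; the values of \<open>y\<close> outside that interval are
  irrelevant.
\<close>

definition W11 :: "real \<Rightarrow> (real \<Rightarrow> real ^ 'n) set"
  where "W11 t = {y. continuous_on {0..t} y \<and>
    (\<exists>g. g absolutely_integrable_on {0<..<t} \<and> has_weak_derivative t y g)}"

text \<open>
  The weak derivative is unique up to a null set, so the choice does not affect integrals.
\<close>

definition weak_deriv :: "real \<Rightarrow> (real \<Rightarrow> real ^ 'n) \<Rightarrow> real \<Rightarrow> real ^ 'n"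
  where "weak_deriv t y =
    (SOME g. g absolutely_integrable_on {0<..<t} \<and> has_weak_derivative t y g)"

text \<open>
  As the Lagrangian is nonnegative, its integral is taken in \<open>[0,\<infinity>]\<close>, and the terminal cost has
  values in the same set.
\<close>

definition Bolza_cost ::
    "(real ^ 'n \<Rightarrow> real ^ 'n \<Rightarrow> real) \<Rightarrow> (real ^ 'n \<Rightarrow> ennreal) \<Rightarrow> real \<Rightarrow> (real \<Rightarrow> real ^ 'n) \<Rightarrow> ennreal"
  where "Bolza_cost L \<phi> t y =
    (\<integral>\<^sup>+ s\<in>{0..t}. ennreal (L (y s) (weak_deriv t y s)) \<partial>lebesgue) + \<phi> (y t)"

definition admissible :: "real \<Rightarrow> real ^ 'n \<Rightarrow> (real \<Rightarrow> real ^ 'n) set"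
  where "admissible t x = {y \<in> W11 t. y 0 = x}"

text \<open>
  The value function lives on \<open>t \<ge> 0\<close>; it is extended by \<open>\<infinity>\<close>, so that lower limits ignore points
  with negative time.
\<close>

definition value_function ::
    "(real ^ 'n \<Rightarrow> real ^ 'n \<Rightarrow> real) \<Rightarrow> (real ^ 'n \<Rightarrow> ennreal) \<Rightarrow> real \<times> (real ^ 'n) \<Rightarrow> ereal"
  where "value_function L \<phi> = (\<lambda>(t, x).
    if t < 0 then \<infinity> else enn2ereal (INF y\<in>admissible t x. Bolza_cost L \<phi> t y))"

definition is_minimizer ::
    "(real ^ 'n \<Rightarrow> real ^ 'n \<Rightarrow> real) \<Rightarrow> (real ^ 'n \<Rightarrow> ennreal) \<Rightarrow> real \<Rightarrow> real ^ 'n \<Rightarrow>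
      (real \<Rightarrow> real ^ 'n) \<Rightarrow> bool"
  where "is_minimizer L \<phi> t x y \<longleftrightarrow>
    y \<in> admissible t x \<and> (\<forall>z\<in>admissible t x. Bolza_cost L \<phi> t y \<le> Bolza_cost L \<phi> t z)"

definition hamiltonian :: "(real ^ 'n \<Rightarrow> real ^ 'n \<Rightarrow> real) \<Rightarrow> real ^ 'n \<Rightarrow> real ^ 'n \<Rightarrow> ereal"
  where "hamiltonian L x p = (SUP u. ereal (p \<bullet> u - L x u))"

definition effective_domain :: "('a \<Rightarrow> ereal) \<Rightarrow> 'a set"
  where "effective_domain F = {z. F z < \<infinity>}"

definition lower_derivative :: "('a::real_normed_vector \<Rightarrow> ereal) \<Rightarrow> 'a \<Rightarrow> 'a \<Rightarrow> ereal"
  where "lower_derivative F z w =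
    Liminf (at_right (0::real) \<times>\<^sub>F nhds w) (\<lambda>(h, w'). (F (z + h *\<^sub>R w') - F z) / ereal h)"

definition subdifferential :: "('a::real_inner \<Rightarrow> ereal) \<Rightarrow> 'a \<Rightarrow> 'a set"
  where "subdifferential F z = (if z \<in> effective_domain F
    then {p. Liminf (at z) (\<lambda>z'. (F z' - F z - ereal (p \<bullet> (z' - z))) / ereal (norm (z' - z))) \<ge> 0}
    else {})"

end

theory Submission
  imports Defs
begin

text \<open>
  A function in \<open>W\<^sup>1\<^sup>,\<^sup>1\<close> is an indefinite integral of its weak derivative, so shifting a curve gives the
  dynamic programming inequality \<open>V(t - h, y h) + \<integral>\<^sub>0\<^sup>h L(y, y') \<le> cost of y\<close>. By convexity, superlinear
  growth and lower semicontinuity, an affine minorant of \<open>L x\<close> persists up to \<open>\<epsilon>\<close> at nearby base points,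
  uniformly in the velocity; integrating it bounds \<open>\<integral>\<^sub>0\<^sup>h L(y, y')\<close> below by the value of the minorant at the mean
  velocity \<open>(y h - x) / h\<close>, which yields the estimate of the lower derivative.

  A subgradient of \<open>V\<close> bounds \<open>V(t - h, y h)\<close> from below, hence the action on \<open>[0, h]\<close> from above by an affine
  function of \<open>h\<close> and \<open>|y h - x|\<close>, and superlinearity bounds \<open>|y h - x| / h\<close>. The same estimate for
  \<open>h\<^sup>2\<close>-minimizers gives the supersolution property without existence of minimizers. If instead \<open>L\<close> is locally
  bounded for small velocities, the bound comes from comparing the minimizer with a time change of itself.
\<close>

section \<open>Lebesgue integrals on the line\<close>

text \<open>In the case without a subgradient nothing controls the cost of a curve leaving the path
  of the minimizer: \<open>\<phi>\<close> may be infinite next to \<open>y t\<close>, and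
  \<open>L\<close> is bounded above only for slow motion. The comparison curve therefore keeps the
  path and changes only the speed. Since the horizon \<open>t\<close> is fixed, the time lost on
  slow arcs has to be regained elsewhere, where no upper growth bound on \<open>L\<close> is
  available. Two facts make this affordable: \<open>L\<close> has finite values, so
  \<open>L (y s) (2 *\<^sub>R g s)\<close> is bounded on some set of positive measure; and convexity
  on the segment from a velocity to its double turns that bound into a cost proportional to the
  acceleration. A superlinear \<open>L\<close> then saves more on the fast arcs than both charges,
  up to a multiple of \<open>h\<close>.

  The definitions use a chosen weak derivative and the completed measure, while Fubini, shifts and
  time changes are carried out for Borel densities on \<open>lborel\<close>; this gap is closed
  once, before any variational argument.\<close>

lemma lborel_integrable_AE_0_of_atMost:
  fixes f :: "real \<Rightarrow> 'a::{second_countable_topology, banach}"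
  assumes f: "integrable lborel f" and 0: "\<And>c. (LINT s:{..c}|lborel. f s) = 0"
  shows "AE s in lborel. f s = 0"
proof -
  have intA: "set_integrable lborel A f" if "A \<in> sets borel" for A
    unfolding set_integrable_def using integrable_mult_indicator[OF _ f] that by simp
  have U: "integral\<^sup>L lborel f = 0"
  proof -
    have "((\<lambda>c. LINT s:{..c}|lborel. f s) \<longlongrightarrow> integral\<^sup>L lborel f) at_top"
      using tendsto_integral_at_top[of lborel f] f by (simp add: set_lebesgue_integral_def)
    then have "((\<lambda>c::real. 0) \<longlongrightarrow> integral\<^sup>L lborel f) at_top"
      by (simp only: 0)
    then show ?thesis
      by (metis tendsto_const_iff trivial_limit_at_top_linorder)
  qed
  \<comment> \<open>The sets over which \<open>f\<close> integrates to zero form a Dynkin system,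
    and half-lines are an intersection-stable generator of the Borel sets. The vanishing total
    integral \<open>U\<close>, the limit along half-lines, is what gives complements.\<close>
  have *: "(LINT s:B|lborel. f s) = 0" if "B \<in> sets borel" for B
  proof -
    have B: "B \<in> sigma_sets UNIV (range atMost)"
      using that by (simp add: borel_eq_atMost)
    have stable: "Int_stable (range (atMost::real \<Rightarrow> _))"
      by (auto simp: Int_stable_def)
    show ?thesis
    proof (rule sigma_sets_induct_disjoint[OF stable _ B, where P = "\<lambda>B. (LINT s:B|lborel. f s) = 0"])
      show "range (atMost::real \<Rightarrow> _) \<subseteq> Pow UNIV" by auto
    next
      fix A assume "A \<in> range (atMost::real \<Rightarrow> _)" then show "(LINT s:A|lborel. f s) = 0" using 0 by auto
    next
      show "(LINT s:{}|lborel. f s) = 0" by (simp add: set_lebesgue_integral_def)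
    next
      fix A assume A: "A \<in> sigma_sets UNIV (range (atMost::real \<Rightarrow> _))" and z: "(LINT s:A|lborel. f s) = 0"
      then have A': "A \<in> sets borel" by (simp add: borel_eq_atMost)
      have "(LINT s:A \<union> (UNIV - A)|lborel. f s) = (LINT s:A|lborel. f s) + (LINT s:UNIV - A|lborel. f s)"
        using A' by (intro set_integral_Un intA) auto
      then show "(LINT s:UNIV - A|lborel. f s) = 0"
        using z U by (simp add: set_lebesgue_integral_def)
    next
      fix X :: "nat \<Rightarrow> real set"
      assume d: "disjoint_family X" and X: "range X \<subseteq> sigma_sets UNIV (range atMost)"
        and z: "\<And>i. (LINT s:X i|lborel. f s) = 0"
      from X have X': "X i \<in> sets borel" for i by (auto simp: borel_eq_atMost)
      have "(LINT s:(\<Union>i. X i)|lborel. f s) = (\<Sum>i. LINT s:X i|lborel. f s)"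
        using X' d by (intro lebesgue_integral_countable_add intA) (auto simp: disjoint_family_on_def)
      then show "(LINT s:(\<Union>i. X i)|lborel. f s) = 0" using z by simp
    qed
  qed
  show ?thesis
    by (rule sigma_finite_measure.density_zero[OF sigma_finite_lborel f]) (use * in simp)
qed

lemma lborel_integral_singleton:
  fixes g :: "real \<Rightarrow> 'a::{second_countable_topology, banach}"
  shows "(LINT r:{a}|lborel. g r) = 0"
proof -
  have "(\<lambda>r. indicator {a} r *\<^sub>R g r) = (\<lambda>r. indicator {a} r *\<^sub>R g a)"
    by (auto simp: indicator_def)
  then show ?thesis
    unfolding set_lebesgue_integral_def by simp
qed

text \<open>Coordinatewise from the real case. Weak derivatives are only Lebesgue measurable,
  whereas densities on \<open>lborel\<close> have to be Borel.\<close>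

lemma lebesgue_measurable_AE_eq_borel:
  fixes g :: "real \<Rightarrow> 'a::euclidean_space"
  assumes "g \<in> borel_measurable lebesgue"
  shows "\<exists>g'\<in>borel_measurable borel. AE s in lborel. g s = g' s"
proof -
  have "\<forall>b. \<exists>h. h \<in> borel_measurable lborel \<and> (AE s in lborel. g s \<bullet> b = (h s :: real))"
    using assms by (intro allI completion_ex_borel_measurable_real[unfolded Bex_def]) auto
  then obtain h :: "'a \<Rightarrow> real \<Rightarrow> real"
    where h: "\<And>b. h b \<in> borel_measurable lborel" "\<And>b. AE s in lborel. g s \<bullet> b = h b s"
    by metis
  have "AE s in lborel. \<forall>b\<in>Basis. g s \<bullet> b = h b s"
    using h(2) by (intro AE_finite_allI) auto
  then have "AE s in lborel. g s = (\<Sum>b\<in>Basis. h b s *\<^sub>R b)"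
    by eventually_elim (metis (no_types, lifting) euclidean_representation sum.cong)
  moreover have "(\<lambda>s. \<Sum>b\<in>Basis. h b s *\<^sub>R b) \<in> borel_measurable borel"
    using h(1) by auto
  ultimately show ?thesis by (rule bexI)
qed

section \<open>Sobolev curves as indefinite integrals\<close>

text \<open>Absolute continuity in integral form. Integrability over the whole line makes
  \<open>g\<close> Borel and lets it be restricted, shifted and pushed forward without a domain; its
  values off \<open>{0..t}\<close> do not affect the equation.\<close>

definition has_density :: "real \<Rightarrow> (real \<Rightarrow> 'a::{second_countable_topology, banach}) \<Rightarrow> (real \<Rightarrow> 'a) \<Rightarrow> bool"
  where "has_density t y g \<longleftrightarrow> integrable lborel g \<and>
    (\<forall>s\<in>{0..t}. y s = y 0 + (LINT r:{0..s}|lborel. g r))"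

lemma continuous_on_integral_Icc:
  fixes g :: "real \<Rightarrow> 'a::{second_countable_topology, banach}"
  assumes g: "integrable lborel g"
  shows "continuous_on S (\<lambda>s. LINT r:{a..s}|lborel. g r)"
proof (rule continuous_on_sequentiallyI)
  fix u :: "nat \<Rightarrow> real" and c assume u: "u \<longlonglongrightarrow> c"
  show "(\<lambda>n. LINT r:{a..u n}|lborel. g r) \<longlonglongrightarrow> (LINT r:{a..c}|lborel. g r)"
    unfolding set_lebesgue_integral_def
  proof (rule integral_dominated_convergence[where w = "\<lambda>r. norm (g r)"])
    have "(\<lambda>n. indicator {a..u n} r *\<^sub>R g r) \<longlonglongrightarrow> indicator {a..c} r *\<^sub>R g r" if "r \<noteq> c" for r
    proof (rule tendsto_eventually)
      show "\<forall>\<^sub>F n in sequentially. indicator {a..u n} r *\<^sub>R g r = indicator {a..c} r *\<^sub>R g r"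
      proof (cases "r < c")
        case True
        then show ?thesis using order_tendstoD(1)[OF u True]
          by (auto elim!: eventually_mono simp: indicator_def)
      next
        case False
        then have "c < r" using that by simp
        show ?thesis using order_tendstoD(2)[OF u \<open>c < r\<close>]
          by eventually_elim (use \<open>c < r\<close> in \<open>auto simp: indicator_def\<close>)
      qed
    qed
    then show "AE r in lborel. (\<lambda>n. indicator {a..u n} r *\<^sub>R g r) \<longlonglongrightarrow> indicator {a..c} r *\<^sub>R g r"
      by (intro eventually_mono[OF AE_lborel_singleton[of c]])
    show "AE r in lborel. norm (indicator {a..u n} r *\<^sub>R g r) \<le> norm (g r)" for n
      by (auto simp: indicator_def)
  qed (use g in auto)
qed

lemma has_density_integrable: "has_density t y g \<Longrightarrow> integrable lborel g"
  by (simp only: has_density_def)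

lemma has_density_eq:
  "has_density t y g \<Longrightarrow> 0 \<le> s \<Longrightarrow> s \<le> t \<Longrightarrow> y s = y 0 + (LINT r:{0..s}|lborel. g r)"
  unfolding has_density_def by (meson atLeastAtMost_iff)

lemma has_density_continuous_on:
  assumes "has_density t y g" shows "continuous_on {0..t} y"
proof (rule continuous_on_eq)
  show "continuous_on {0..t} (\<lambda>s. y 0 + (LINT r:{0..s}|lborel. g r))"
    using has_density_integrable[OF assms]
    by (intro continuous_intros continuous_on_integral_Icc)
  show "y 0 + (LINT r:{0..s}|lborel. g r) = y s" if "s \<in> {0..t}" for s
    using has_density_eq[OF assms, of s] that by simp
qed

text \<open>By Fubini on the triangle \<open>0 \<le> r \<le> s\<close>.\<close>

lemma has_density_integral_by_parts:
  fixes g :: "real \<Rightarrow> 'a::euclidean_space"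
  assumes y: "has_density t y g"
    and D: "\<And>s. (\<psi> has_real_derivative D s) (at s)" "continuous_on UNIV D"
    and K: "compact K" "K \<subseteq> {0<..<t}" "\<And>s. s \<notin> K \<Longrightarrow> \<psi> s = 0"
  shows "(LINT s:{0<..<t}|lborel. D s *\<^sub>R y s) = - (LINT s|lborel. \<psi> s *\<^sub>R g s)"
proof -
  have g: "integrable lborel g"
    and ys: "0 \<le> s \<Longrightarrow> s \<le> t \<Longrightarrow> y s = y 0 + (LINT r:{0..s}|lborel. g r)" for s
    by (rule has_density_integrable[OF y], rule has_density_eq[OF y])
  have D0: "D s = 0" if "s \<notin> K" for s
  proof -
    have "open (- K)" using K(1) by (simp add: compact_imp_closed open_Compl)
    then have "(\<psi> has_real_derivative 0) (at s)"
      using that K(3) by (intro DERIV_cong_ev[THEN iffD2, OF refl _ refl DERIV_const[of 0]])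
        (auto simp: eventually_nhds)
    then show ?thesis using DERIV_unique[OF D(1)] by auto
  qed
  have D0': "D s = 0" if "s \<le> 0 \<or> t \<le> s" for s
    using D0 K(2) that by fastforce
  have \<psi>0: "\<psi> s = 0" if "s \<le> 0 \<or> t \<le> s" for s
    using K(2,3) that by fastforce
  have Dm [measurable]: "D \<in> borel_measurable borel"
    using D(2) by (rule borel_measurable_continuous_onI)
  \<comment> \<open>\<open>\<psi>\<close> and \<open>D\<close> vanish from \<open>t\<close> on, so
    the half-line can replace \<open>{r..t}\<close>, and this also covers \<open>r\<close> beyond
    \<open>t\<close>.\<close>
  have FTC: "has_bochner_integral lborel (\<lambda>s. indicator {r..} s * D s) (- \<psi> r)" for r
  proof (cases "r \<le> t")
    case True
    have "has_bochner_integral lborel (\<lambda>s. indicator {r..t} s *\<^sub>R D s) (\<psi> t - \<psi> r)"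
      using True D by (intro has_bochner_integral_FTC_Icc)
        (auto simp: has_real_derivative_iff_has_vector_derivative[symmetric] intro: DERIV_subset continuous_on_subset)
    moreover have "(\<lambda>s. indicator {r..t} s *\<^sub>R D s) = (\<lambda>s. indicator {r..} s * D s)"
      using D0' by (fastforce simp: indicator_def)
    moreover have "\<psi> t - \<psi> r = - \<psi> r"
      using \<psi>0[of t] by simp
    ultimately show ?thesis by metis
  next
    case False
    then have z: "(\<lambda>s. indicator {r..} s * D s) = (\<lambda>_. 0)"
      using D0' by (fastforce simp: indicator_def)
    show ?thesis unfolding z using False \<psi>0[of r] by (simp add: has_bochner_integral_zero)
  qed
  \<comment> \<open>The case \<open>r = 0\<close>: \<open>D\<close> has integral zero, which removes
    the constant \<open>y 0\<close> below.\<close>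
  have "(\<lambda>s. indicator {0..} s * D s) = D"
    using D0' by (fastforce simp: indicator_def)
  then have Dint: "integrable lborel D" and Dz: "integral\<^sup>L lborel D = 0"
    using FTC[of 0] \<psi>0[of 0] by (simp_all add: has_bochner_integral_iff)
  define F where "F = (\<lambda>s r. D s *\<^sub>R indicator {0..s} r *\<^sub>R g r)"
  have gm [measurable]: "g \<in> borel_measurable borel" using g by auto
  have Fm: "case_prod F \<in> borel_measurable (lborel \<Otimes>\<^sub>M lborel)"
  proof -
    have "case_prod F = (\<lambda>p. (D (fst p) * (if 0 \<le> snd p \<and> snd p \<le> fst p then 1 else 0)) *\<^sub>R g (snd p))"
      by (auto simp: F_def indicator_def)
    then show ?thesis by simp
  qed
  have Fint: "integrable (lborel \<Otimes>\<^sub>M lborel) (case_prod F)"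
  proof (rule lborel_pair.Fubini_integrable[OF Fm])
    have *: "integrable lborel (\<lambda>r. indicator {0..s} r *\<^sub>R g r)" for s
      using integrable_mult_indicator[OF _ g] by simp
    show "AE s in lborel. integrable lborel (\<lambda>r. case_prod F (s, r))"
      using * by (simp add: F_def del: scaleR_scaleR)
    show "integrable lborel (\<lambda>s. LINT r|lborel. norm (case_prod F (s, r)))"
    proof (rule Bochner_Integration.integrable_bound)
      show "integrable lborel (\<lambda>s. norm (D s) * (LINT r|lborel. norm (g r)))"
        using Dint by auto
      show "(\<lambda>s. LINT r|lborel. norm (case_prod F (s, r))) \<in> borel_measurable lborel"
        using Fm by measurable
      have "(LINT r|lborel. norm (F s r)) \<le> (LINT r|lborel. norm (D s) * norm (g r))" for s
        using g * by (intro integral_mono integrable_norm)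
          (auto simp: F_def indicator_def simp del: scaleR_scaleR intro!: integrable_scaleR_right)
      then show "AE s in lborel. norm (LINT r|lborel. norm (case_prod F (s, r)))
          \<le> norm (norm (D s) * (LINT r|lborel. norm (g r)))"
        by (auto intro!: AE_I2)
    qed
  qed
  have "(LINT s:{0<..<t}|lborel. D s *\<^sub>R y s) = (LINT s|lborel. D s *\<^sub>R y 0 + (LINT r|lborel. F s r))"
    unfolding set_lebesgue_integral_def
  proof (rule Bochner_Integration.integral_cong[OF refl])
    fix s
    have "(LINT r|lborel. F s r) = D s *\<^sub>R (LINT r:{0..s}|lborel. g r)"
      unfolding set_lebesgue_integral_def F_def
      by (simp del: scaleR_scaleR)
    then show "indicator {0<..<t} s *\<^sub>R D s *\<^sub>R y s = D s *\<^sub>R y 0 + (LINT r|lborel. F s r)"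
      using ys[of s] D0'[of s] by (cases "0 < s \<and> s < t") (auto simp: scaleR_add_right)
  qed
  also have "\<dots> = (LINT s|lborel. D s *\<^sub>R y 0) + (LINT s|lborel. LINT r|lborel. F s r)"
    using Dint lborel_pair.integrable_fst'[OF Fint] by (intro Bochner_Integration.integral_add) auto
  also have "(LINT s|lborel. D s *\<^sub>R y 0) = 0"
    using Dz Dint by simp
  also have "(LINT s|lborel. LINT r|lborel. F s r) = (LINT r|lborel. LINT s|lborel. F s r)"
    using lborel_pair.Fubini_integral[OF Fint] by simp
  also have "\<dots> = (LINT r|lborel. - (\<psi> r *\<^sub>R g r))"
  proof (rule Bochner_Integration.integral_cong[OF refl])
    fix r
    have "(\<lambda>s. F s r) = (\<lambda>s. (indicator {r..} s * D s) *\<^sub>R indicator {0..} r *\<^sub>R g r)"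
      by (auto simp: F_def indicator_def)
    then have "(LINT s|lborel. F s r) = - \<psi> r *\<^sub>R indicator {0..} r *\<^sub>R g r"
      using FTC[of r] by (simp add: has_bochner_integral_iff del: scaleR_scaleR)
    then show "(LINT s|lborel. F s r) = - (\<psi> r *\<^sub>R g r)"
      using \<psi>0[of r] by (cases "0 \<le> r") (auto simp: indicator_def)
  qed
  finally show ?thesis by simp
qed

section \<open>The du Bois-Reymond lemma\<close>

lemma has_real_derivative_max_0_sq:
  "((\<lambda>s. (max 0 s)\<^sup>2 / 2) has_real_derivative max 0 s) (at (s::real))"
proof (cases s "0::real" rule: linorder_cases)
  case less
  have "((\<lambda>s::real. 0) has_real_derivative 0) (at s)" by simp
  moreover have "\<forall>\<^sub>F r in nhds s. (max 0 r)\<^sup>2 / 2 = 0"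
    using eventually_nhds_in_open[of "{..<0}" s] less by (auto elim!: eventually_mono)
  ultimately show ?thesis
    using less by (subst DERIV_cong_ev[OF refl, of _ "\<lambda>_. 0"]) auto
next
  case equal
  have "((\<lambda>h::real. max 0 h / 2) \<longlongrightarrow> 0) (at 0)"
    by (intro tendsto_eq_intros) auto
  moreover have "\<forall>\<^sub>F h::real in at 0. max 0 h / 2 = ((max 0 (0 + h))\<^sup>2 / 2 - (max 0 0)\<^sup>2 / 2) / h"
    by (auto simp: eventually_at power2_eq_square max_def intro!: exI[of _ 1])
  ultimately show ?thesis
    unfolding DERIV_def equal by (auto elim: Lim_transform_eventually)
next
  case greater
  have "((\<lambda>s::real. s\<^sup>2 / 2) has_real_derivative s) (at s)"
    by (auto intro!: derivative_eq_intros)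
  moreover have "\<forall>\<^sub>F r in nhds s. (max 0 r)\<^sup>2 / 2 = r\<^sup>2 / 2"
    using eventually_nhds_in_open[of "{0<..}" s] greater by (auto elim!: eventually_mono)
  ultimately show ?thesis
    using greater by (subst DERIV_cong_ev[OF refl, of _ "\<lambda>s. s\<^sup>2 / 2"]) auto
qed

text \<open>The second difference of \<open>(max 0 s)\<^sup>2 / 2\<close> with step \<open>e\<close> is a primitive of a tent of width \<open>2 * e\<close>.\<close>

definition tent_primitive :: "real \<Rightarrow> real \<Rightarrow> real \<Rightarrow> real"
  where "tent_primitive e c s = (max 0 (s - c + e))\<^sup>2 / 2 - 2 * ((max 0 (s - c))\<^sup>2 / 2) + (max 0 (s - c - e))\<^sup>2 / 2"

definition tent :: "real \<Rightarrow> real \<Rightarrow> real \<Rightarrow> real"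
  where "tent e c s = max 0 (e - \<bar>s - c\<bar>)"

lemma tent_primitive_deriv:
  assumes "0 < e"
  shows "(tent_primitive e c has_real_derivative tent e c s) (at s)"
proof -
  have d: "((\<lambda>s. (max 0 (s - c + k))\<^sup>2 / 2) has_real_derivative max 0 (s - c + k)) (at s)" for k
    by (rule DERIV_cong[OF DERIV_chain2[where f = "\<lambda>s. (max 0 s)\<^sup>2 / 2" and g = "\<lambda>s. s - c + k",
        OF has_real_derivative_max_0_sq]]) (auto intro!: derivative_eq_intros)
  have "(tent_primitive e c has_real_derivative
      max 0 (s - c + e) - 2 * max 0 (s - c) + max 0 (s - c - e)) (at s)"
    unfolding tent_primitive_def[abs_def]
    using d[of e] d[of 0] d[of "-e"] by (intro DERIV_add DERIV_diff DERIV_cmult) simp_all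
  moreover have "max 0 (s - c + e) - 2 * max 0 (s - c) + max 0 (s - c - e) = tent e c s"
    using assms by (auto simp: tent_def max_def abs_if)
  ultimately show ?thesis by simp
qed

lemma tent_primitive_left: "0 < e \<Longrightarrow> s \<le> c - e \<Longrightarrow> tent_primitive e c s = 0"
  by (simp add: tent_primitive_def max_def)

lemma tent_primitive_right: "0 < e \<Longrightarrow> c + e \<le> s \<Longrightarrow> tent_primitive e c s = e\<^sup>2"
  by (simp add: tent_primitive_def max_def power2_eq_square field_simps)

lemma continuous_on_tent [continuous_intros]: "continuous_on S (tent e c)"
  unfolding tent_def[abs_def] by (intro continuous_intros)

lemma tent_integral:
  assumes "0 < e" "0 \<le> c - e" "c + e \<le> t"
  shows "(tent e c has_integral e\<^sup>2) {0..t}"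
proof -
  have "(tent e c has_integral tent_primitive e c t - tent_primitive e c 0) {0..t}"
    using assms tent_primitive_deriv[of e c]
    by (intro fundamental_theorem_of_calculus)
       (auto simp flip: has_real_derivative_iff_has_vector_derivative intro: DERIV_subset)
  then show ?thesis
    using assms by (simp add: tent_primitive_left tent_primitive_right)
qed

text \<open>Tested with the primitive of the difference of two tents centred at two points of the interval.\<close>

lemma du_Bois_Reymond:
  fixes d :: "real \<Rightarrow> 'a::euclidean_space"
  assumes d: "continuous_on {0..t} d"
    and test: "\<And>\<psi> D K. (\<And>s. (\<psi> has_real_derivative D s) (at s)) \<Longrightarrow> continuous_on UNIV D \<Longrightarrow>
      compact K \<Longrightarrow> K \<subseteq> {0<..<t} \<Longrightarrow> (\<And>s. s \<notin> K \<Longrightarrow> \<psi> s = 0) \<Longrightarrow>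
      integral {0..t} (\<lambda>s. D s *\<^sub>R d s) = 0"
    and s: "s \<in> {0..t}"
  shows "d s = d 0"
proof -
  have eq: "d a = d b" if ab: "0 < a" "a < b" "b < t" for a b
  proof (rule ccontr)
    assume "d a \<noteq> d b"
    \<comment> \<open>Projecting on \<open>v\<close> gives a scalar function whose values at
      \<open>a\<close> and \<open>b\<close> differ by \<open>v \<bullet> v\<close>. The level
      \<open>m\<close> is their midpoint and \<open>4 * k\<close> their difference, so near
      \<open>a\<close> the function exceeds \<open>m\<close> by at least \<open>k\<close>, and near
      \<open>b\<close> it falls below by as much. The two tents have equal integrals, so subtracting
      \<open>m\<close> does not change the tested integral, which then has to be positive.\<close>
    define v where "v = d a - d b"
    define f where "f = (\<lambda>s. v \<bullet> d s)"
    define m where "m = (f a + f b) / 2"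
    define k where "k = (f a - f b) / 4"
    have "f a - f b = v \<bullet> v"
      by (simp add: f_def v_def inner_diff_right)
    with \<open>d a \<noteq> d b\<close> have k: "0 < k"
      by (simp add: k_def v_def)
    have m: "m = f a - 2 * k" "m = f b + 2 * k"
      by (simp_all add: m_def k_def field_simps)
    have f: "continuous_on {0..t} f"
      unfolding f_def by (intro continuous_intros d)
    have ex: "\<exists>e>0. \<forall>s\<in>{0..t}. \<bar>s - c\<bar> < e \<longrightarrow> \<bar>f s - f c\<bar> < k" if "c \<in> {0..t}" for c
      using f[unfolded continuous_on_iff, rule_format, OF that k] by (auto simp: dist_real_def)
    obtain e1 where e1: "e1 > 0" "\<And>s. s \<in> {0..t} \<Longrightarrow> \<bar>s - a\<bar> < e1 \<Longrightarrow> \<bar>f s - f a\<bar> < k"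
      using ex[of a] ab by auto
    obtain e2 where e2: "e2 > 0" "\<And>s. s \<in> {0..t} \<Longrightarrow> \<bar>s - b\<bar> < e2 \<Longrightarrow> \<bar>f s - f b\<bar> < k"
      using ex[of b] ab by auto
    \<comment> \<open>Halving keeps the supports of both tents inside the open interval.\<close>
    define e where "e = min (min e1 e2) (min a (t - b)) / 2"
    have e: "0 < e" "e \<le> e1" "e \<le> e2" "e < a" "e < t - b"
      using ab e1(1) e2(1) by (auto simp: e_def min_def)
    define \<psi> where "\<psi> = (\<lambda>s. tent_primitive e a s - tent_primitive e b s)"
    define D where "D = (\<lambda>s. tent e a s - tent e b s)"
    have "integral {0..t} (\<lambda>s. D s *\<^sub>R d s) = 0"
    proof (rule test)
      show "(\<psi> has_real_derivative D s) (at s)" for s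
        unfolding \<psi>_def D_def using e(1) by (intro DERIV_diff tent_primitive_deriv)
      show "continuous_on UNIV D"
        unfolding D_def by (intro continuous_intros)
      show "{a - e..b + e} \<subseteq> {0<..<t}"
        using e by auto
      show "\<psi> s = 0" if "s \<notin> {a - e..b + e}" for s
      proof (cases "s < a - e")
        case True
        then show ?thesis using e ab by (simp add: \<psi>_def tent_primitive_left)
      next
        case False
        then show ?thesis using that e ab by (simp add: \<psi>_def tent_primitive_right)
      qed
    qed simp
    moreover have Dd: "continuous_on {0..t} (\<lambda>s. D s *\<^sub>R d s)"
      unfolding D_def by (intro continuous_intros d)
    ultimately have "((\<lambda>s. D s *\<^sub>R d s) has_integral 0) {0..t}"
      by (metis integrable_continuous_interval integrable_integral)
    from has_integral_linear[OF this bounded_linear_inner_right[of v]]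
    have Df: "((\<lambda>s. D s * f s) has_integral 0) {0..t}"
      by (simp add: o_def f_def)
    have ta: "(tent e a has_integral e\<^sup>2) {0..t}" and tb: "(tent e b has_integral e\<^sup>2) {0..t}"
      using e ab by (auto intro!: tent_integral)
    have "(D has_integral 0) {0..t}"
      using has_integral_diff[OF ta tb] by (simp add: D_def)
    from has_integral_diff[OF Df has_integral_mult_left[OF this, of m]]
    have lhs: "((\<lambda>s. D s * f s - D s * m) has_integral 0) {0..t}" by simp
    have rhs: "((\<lambda>s. tent e a s * k + tent e b s * k) has_integral e\<^sup>2 * k + e\<^sup>2 * k) {0..t}"
      by (intro has_integral_add has_integral_mult_left ta tb)
    have "e\<^sup>2 * k + e\<^sup>2 * k \<le> 0"
    proof (rule has_integral_le[OF rhs lhs])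
      fix s assume s: "s \<in> {0..t}"
      have "tent e a s * k \<le> tent e a s * (f s - m)"
      proof (cases "\<bar>s - a\<bar> < e")
        case True
        then have "k \<le> f s - m"
          using e1(2)[OF s] e m by linarith
        then show ?thesis by (intro mult_left_mono) (auto simp: tent_def)
      qed (simp add: tent_def)
      moreover have "tent e b s * k \<le> tent e b s * (m - f s)"
      proof (cases "\<bar>s - b\<bar> < e")
        case True
        then have "k \<le> m - f s"
          using e2(2)[OF s] e m by linarith
        then show ?thesis by (intro mult_left_mono) (auto simp: tent_def)
      qed (simp add: tent_def)
      ultimately show "tent e a s * k + tent e b s * k \<le> D s * f s - D s * m"
        by (simp add: D_def algebra_simps)
    qed
    moreover have "0 < e\<^sup>2 * k"
      using e(1) k by simp
    ultimately show False by linarith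
  qed
  show ?thesis
  proof (cases "0 < t")
    case True
    have "d r = d (t/2)" if "r \<in> {0<..<t}" for r
    proof (cases r "t/2" rule: linorder_cases)
      case less
      then show ?thesis using that by (intro eq) auto
    next
      case greater
      then show ?thesis using that by (intro eq[symmetric]) auto
    qed (metis)
    then obtain c where "\<And>r. r \<in> {0<..<t} \<Longrightarrow> d r = c" by metis
    then have "d ` closure {0<..<t} \<subseteq> {c}"
      using d True by (intro image_closure_subset) (simp_all add: image_subset_iff)
    then have "d r = c" if "r \<in> {0..t}" for r
      using True that by (simp add: image_subset_iff)
    from this[OF s] this[of 0] True show ?thesis by simp
  next
    case False
    with s have "s = 0" by simp
    then show ?thesis by (rule arg_cong)
  qed
qed

section \<open>Densities and weak derivatives\<close>

lemma has_density_AE_unique: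
  fixes g :: "real \<Rightarrow> 'a::euclidean_space"
  assumes g: "has_density t y g" and g': "has_density t y g'"
  shows "AE s in lborel. s \<in> {0..t} \<longrightarrow> g s = g' s"
proof -
  have int: "integrable lborel g" "integrable lborel g'"
    using g g' by (auto dest: has_density_integrable)
  then have dint: "integrable lborel (\<lambda>s. g s - g' s)" by auto
  \<comment> \<open>Cutting off to \<open>{0..t}\<close> turns equality of the primitives into
    vanishing integrals over all half-lines.\<close>
  have "AE s in lborel. indicator {0..t} s *\<^sub>R (g s - g' s) = 0"
  proof (rule lborel_integrable_AE_0_of_atMost)
    show "integrable lborel (\<lambda>s. indicator {0..t} s *\<^sub>R (g s - g' s))"
      using integrable_mult_indicator[OF _ dint] by simp
    fix c :: real
    show "(LINT s:{..c}|lborel. indicator {0..t} s *\<^sub>R (g s - g' s)) = 0"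
    proof (cases "0 \<le> min c t")
      case True
      have si: "set_integrable lborel {0..min c t} g" "set_integrable lborel {0..min c t} g'"
        unfolding set_integrable_def using int by (auto intro!: integrable_mult_indicator)
      have "(LINT s:{..c}|lborel. indicator {0..t} s *\<^sub>R (g s - g' s)) = (LINT s:{0..min c t}|lborel. g s - g' s)"
        unfolding set_lebesgue_integral_def by (auto simp: indicator_def intro!: Bochner_Integration.integral_cong)
      also have "\<dots> = (LINT s:{0..min c t}|lborel. g s) - (LINT s:{0..min c t}|lborel. g' s)"
        using si by (intro set_integral_diff)
      also have "\<dots> = 0"
      proof -
        have "min c t \<in> {0..t}" using True by auto
        then have "y 0 + (LINT s:{0..min c t}|lborel. g s) = y 0 + (LINT s:{0..min c t}|lborel. g' s)"
          using has_density_eq[OF g] has_density_eq[OF g'] by (metis atLeastAtMost_iff)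
        then show ?thesis by simp
      qed
      finally show ?thesis .
    next
      case False
      then have "(\<lambda>s. indicator {..c} s *\<^sub>R indicator {0..t} s *\<^sub>R (g s - g' s)) = (\<lambda>_. 0)"
        by (auto simp: indicator_def)
      then show ?thesis unfolding set_lebesgue_integral_def by simp
    qed
  qed
  then show ?thesis
    by eventually_elim (auto simp: indicator_def)
qed

lemma has_density_has_weak_derivative:
  fixes g :: "real \<Rightarrow> real ^ 'n"
  assumes y: "has_density t y g"
  shows "g absolutely_integrable_on {0<..<t}" "has_weak_derivative t y g"
proof -
  have g: "integrable lborel g" using y by (rule has_density_integrable)
  have gl: "integrable lebesgue g"
    using g integrable_completion[of g lborel] by auto
  show "g absolutely_integrable_on {0<..<t}"
    unfolding set_integrable_def using integrable_mult_indicator[OF _ gl] by simp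
  show "has_weak_derivative t y g"
    unfolding has_weak_derivative_def
  proof (intro allI impI, elim conjE exE)
    fix \<psi> :: "real \<Rightarrow> real" and K
    assume "\<psi> C1_differentiable_on UNIV" and K: "compact K" "K \<subseteq> {0<..<t}" "\<forall>s. s \<notin> K \<longrightarrow> \<psi> s = 0"
    then obtain D where D: "\<And>s. (\<psi> has_real_derivative D s) (at s)" "continuous_on UNIV D"
      unfolding C1_differentiable_on_def has_real_derivative_iff_has_vector_derivative by auto
    have [simp]: "deriv \<psi> = D"
      using D(1) by (auto intro: DERIV_imp_deriv)
    have y': "continuous_on {0<..<t} y"
      using has_density_continuous_on[OF y] by (rule continuous_on_subset) auto
    have m1: "(\<lambda>s. indicator {0<..<t} s *\<^sub>R D s *\<^sub>R y s) \<in> borel_measurable lborel"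
      unfolding measurable_lborel2
      by (intro borel_measurable_continuous_on_indicator continuous_intros y' continuous_on_subset[OF D(2)]) auto
    have \<psi>: "\<psi> \<in> borel_measurable borel"
      using D(1) by (intro borel_measurable_continuous_onI) (meson DERIV_continuous_on has_field_derivative_at_within)
    have m2: "(\<lambda>s. indicator {0<..<t} s *\<^sub>R \<psi> s *\<^sub>R g s) \<in> borel_measurable lborel"
      using \<psi> g by (auto intro!: borel_measurable_scaleR)
    have "(LINT s:{0<..<t}|lebesgue. D s *\<^sub>R y s) = (LINT s:{0<..<t}|lborel. D s *\<^sub>R y s)"
      unfolding set_lebesgue_integral_def using m1 by (rule integral_completion)
    also have "\<dots> = - (LINT s|lborel. \<psi> s *\<^sub>R g s)"
      using K by (intro has_density_integral_by_parts[OF y D]) auto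
    also have "(LINT s|lborel. \<psi> s *\<^sub>R g s) = (LINT s:{0<..<t}|lborel. \<psi> s *\<^sub>R g s)"
      unfolding set_lebesgue_integral_def using K
      by (intro Bochner_Integration.integral_cong) (auto simp: indicator_def)
    also have "\<dots> = (LINT s:{0<..<t}|lebesgue. \<psi> s *\<^sub>R g s)"
      unfolding set_lebesgue_integral_def using m2 by (rule integral_completion[symmetric])
    finally show "(LINT s:{0<..<t}|lebesgue. deriv \<psi> s *\<^sub>R y s) = - (LINT s:{0<..<t}|lebesgue. \<psi> s *\<^sub>R g s)"
      by simp
  qed
qed

lemma has_density_W11:
  assumes "has_density t y g" shows "y \<in> W11 t"
proof -
  have "\<exists>g. g absolutely_integrable_on {0<..<t} \<and> has_weak_derivative t y g"
    by (rule exI[of _ g], rule conjI) (rule has_density_has_weak_derivative[OF assms])+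
  with has_density_continuous_on[OF assms] show ?thesis
    unfolding W11_def mem_Collect_eq by (rule conjI)
qed

lemma has_weak_derivativeD:
  assumes "has_weak_derivative t y g" "\<psi> C1_differentiable_on UNIV"
    and K: "compact K" "K \<subseteq> {0<..<t}" "\<And>s. s \<notin> K \<Longrightarrow> \<psi> s = 0"
  shows "(LINT s:{0<..<t}|lebesgue. deriv \<psi> s *\<^sub>R y s) = - (LINT s:{0<..<t}|lebesgue. \<psi> s *\<^sub>R g s)"
proof -
  have "\<exists>K. compact K \<and> K \<subseteq> {0<..<t} \<and> (\<forall>s. s \<notin> K \<longrightarrow> \<psi> s = 0)"
    using K by (intro exI[of _ K]) simp
  then show ?thesis
    using assms(1)[unfolded has_weak_derivative_def, rule_format, OF conjI, OF assms(2)] by simp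
qed

text \<open>A primitive \<open>Y\<close> of a Borel version of \<open>g\<close> has the same weak
  derivative as \<open>y\<close>, so their difference is constant on \<open>{0..t}\<close> by the du
  Bois-Reymond lemma; \<open>Y\<close> starts at \<open>y 0\<close>, so the constant is
  zero.\<close>

lemma has_weak_derivative_has_density:
  fixes y :: "real \<Rightarrow> real ^ 'n"
  assumes y: "continuous_on {0..t} y"
    and g: "g absolutely_integrable_on {0<..<t}" "has_weak_derivative t y g"
  obtains g' where "has_density t y g'" "AE s in lborel. s \<in> {0<..<t} \<longrightarrow> g s = g' s"
proof -
  have gi: "integrable lebesgue (\<lambda>s. indicator {0<..<t} s *\<^sub>R g s)"
    using g(1) by (simp add: set_integrable_def)
  then obtain g' where g'm: "g' \<in> borel_measurable borel"
    and eq: "AE s in lborel. indicator {0<..<t} s *\<^sub>R g s = g' s"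
    using lebesgue_measurable_AE_eq_borel[OF borel_measurable_integrable[OF gi]] by auto
  have g'l: "g' \<in> borel_measurable lebesgue"
    using g'm by (intro measurable_completion) simp
  have "integrable lebesgue g'"
    using gi eq g'l by (subst integrable_cong_AE[where g = "\<lambda>s. indicator {0<..<t} s *\<^sub>R g s"])
      (auto intro: AE_completion elim: eventually_mono)
  then have g'i: "integrable lborel g'"
    using g'm integrable_completion[of g' lborel] by simp
  have eq': "AE s in lborel. s \<in> {0<..<t} \<longrightarrow> g s = g' s"
    using eq by eventually_elim auto
  define Y where "Y = (\<lambda>s. y 0 + (LINT r:{0..s}|lborel. g' r))"
  have Y0: "Y 0 = y 0" by (simp add: Y_def lborel_integral_singleton)
  have Y: "has_density t Y g'"
    unfolding has_density_def Y0 by (simp add: Y_def g'i)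
  have yY: "y s - Y s = y 0 - Y 0" if "s \<in> {0..t}" for s
  proof (rule du_Bois_Reymond[OF _ _ that, of "\<lambda>s. y s - Y s"])
    show "continuous_on {0..t} (\<lambda>s. y s - Y s)"
      by (intro continuous_intros y has_density_continuous_on[OF Y])
    fix \<psi> D :: "real \<Rightarrow> real" and K
    assume D: "\<And>s. (\<psi> has_real_derivative D s) (at s)" "continuous_on UNIV D"
      and K: "compact K" "K \<subseteq> {0<..<t}" "\<And>s. s \<notin> K \<Longrightarrow> \<psi> s = 0"
    have C1: "\<psi> C1_differentiable_on UNIV"
      unfolding C1_differentiable_on_def using D
      by (auto simp: has_real_derivative_iff_has_vector_derivative)
    have [simp]: "deriv \<psi> = D"
      using D(1) by (auto intro: DERIV_imp_deriv)
    have Dc: "continuous_on {0..t} D" using D(2) by (rule continuous_on_subset) simp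
    have conv: "set_integrable lebesgue {0<..<t} (\<lambda>s. D s *\<^sub>R z s)"
      "(LINT s:{0<..<t}|lebesgue. D s *\<^sub>R z s) = integral {0..t} (\<lambda>s. D s *\<^sub>R z s)"
      if "continuous_on {0..t} z" for z :: "real \<Rightarrow> real ^ 'n"
    proof -
      have "(\<lambda>s. D s *\<^sub>R z s) absolutely_integrable_on {0..t}"
        using that Dc by (intro absolutely_integrable_continuous_real continuous_intros)
      then show *: "set_integrable lebesgue {0<..<t} (\<lambda>s. D s *\<^sub>R z s)"
        by (rule set_integrable_subset) auto
      show "(LINT s:{0<..<t}|lebesgue. D s *\<^sub>R z s) = integral {0..t} (\<lambda>s. D s *\<^sub>R z s)"
        using * by (simp add: set_lebesgue_integral_eq_integral integral_open_interval_real)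
    qed
    have \<psi>m: "\<psi> \<in> borel_measurable borel"
      using D(1) by (intro borel_measurable_continuous_onI) (meson DERIV_continuous_on has_field_derivative_at_within)
    have ibp: "(LINT s:{0<..<t}|lebesgue. D s *\<^sub>R y s) = - (LINT s:{0<..<t}|lebesgue. \<psi> s *\<^sub>R g s)"
      "(LINT s:{0<..<t}|lebesgue. D s *\<^sub>R Y s) = - (LINT s:{0<..<t}|lebesgue. \<psi> s *\<^sub>R g' s)"
      using has_weak_derivativeD[OF g(2) C1 K] has_weak_derivativeD[OF has_density_has_weak_derivative(2)[OF Y] C1 K]
      by simp_all
    have "(LINT s:{0<..<t}|lebesgue. \<psi> s *\<^sub>R g s) = (LINT s:{0<..<t}|lebesgue. \<psi> s *\<^sub>R g' s)"
      unfolding set_lebesgue_integral_def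
    proof (rule integral_cong_AE)
      have "\<psi> \<in> borel_measurable lebesgue"
        using \<psi>m by (intro measurable_completion) simp
      from borel_measurable_scaleR[OF this borel_measurable_integrable[OF gi]]
      show "(\<lambda>s. indicator {0<..<t} s *\<^sub>R \<psi> s *\<^sub>R g s) \<in> borel_measurable lebesgue"
        by (simp add: mult.commute)
      have "(\<lambda>s. indicator {0<..<t} s *\<^sub>R \<psi> s *\<^sub>R g' s) \<in> borel_measurable lborel"
        using \<psi>m g'm by measurable
      then show "(\<lambda>s. indicator {0<..<t} s *\<^sub>R \<psi> s *\<^sub>R g' s) \<in> borel_measurable lebesgue"
        by (rule measurable_completion)
      show "AE s in lebesgue. indicator {0<..<t} s *\<^sub>R \<psi> s *\<^sub>R g s = indicator {0<..<t} s *\<^sub>R \<psi> s *\<^sub>R g' s"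
        using eq' by (intro AE_completion) (auto elim!: eventually_mono simp: indicator_def)
    qed
    then have "integral {0..t} (\<lambda>s. D s *\<^sub>R y s) = integral {0..t} (\<lambda>s. D s *\<^sub>R Y s)"
      using ibp conv(2) y has_density_continuous_on[OF Y] by metis
    then show "integral {0..t} (\<lambda>s. D s *\<^sub>R (y s - Y s)) = 0"
      unfolding scaleR_diff_right
      by (subst Henstock_Kurzweil_Integration.integral_diff)
         (auto intro!: integrable_continuous_interval continuous_intros Dc y has_density_continuous_on[OF Y])
  qed
  have "has_density t y g'"
    unfolding has_density_def using g'i
  proof (intro conjI ballI)
    fix s assume "s \<in> {0..t}"
    from yY[OF this] show "y s = y 0 + (LINT r:{0..s}|lborel. g' r)"
      unfolding Y0 by (simp add: Y_def)
  qed
  with eq' show ?thesis by (intro that)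
qed

lemma W11_has_density:
  assumes "y \<in> W11 t" obtains g where "has_density t y g"
  using assms unfolding W11_def by (auto elim: has_weak_derivative_has_density)

text \<open>The choice made in \<open>weak_deriv\<close> is harmless: it agrees almost everywhere
  with some density, and densities are unique up to null sets. The endpoints, where a weak
  derivative on the open interval says nothing, are null. From here on costs are computed with
  densities only.\<close>

lemma Bolza_cost_has_density:
  assumes y: "has_density t y g"
  shows "Bolza_cost L \<phi> t y = (\<integral>\<^sup>+ s\<in>{0..t}. ennreal (L (y s) (g s)) \<partial>lborel) + \<phi> (y t)"
proof -
  have "weak_deriv t y absolutely_integrable_on {0<..<t} \<and> has_weak_derivative t y (weak_deriv t y)"
    unfolding weak_deriv_def by (rule someI[of _ g]) (intro conjI has_density_has_weak_derivative[OF y])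
  then obtain g' where g': "has_density t y g'" "AE s in lborel. s \<in> {0<..<t} \<longrightarrow> weak_deriv t y s = g' s"
    using has_weak_derivative_has_density[OF has_density_continuous_on[OF y]] by metis
  have "(\<integral>\<^sup>+ s\<in>{0..t}. ennreal (L (y s) (weak_deriv t y s)) \<partial>lborel)
      = (\<integral>\<^sup>+ s\<in>{0..t}. ennreal (L (y s) (g s)) \<partial>lborel)"
  proof (rule nn_integral_cong_AE)
    show "AE s in lborel. ennreal (L (y s) (weak_deriv t y s)) * indicator {0..t} s
        = ennreal (L (y s) (g s)) * indicator {0..t} s"
      using g'(2) has_density_AE_unique[OF y g'(1)] AE_lborel_singleton[of 0] AE_lborel_singleton[of t]
      by eventually_elim (auto simp: indicator_def)
  qed
  then show ?thesis
    unfolding Bolza_cost_def by (simp add: nn_integral_completion)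
qed

section \<open>Displacement, shift and change of time\<close>

lemma has_density_displacement:
  fixes g :: "real \<Rightarrow> 'a::{second_countable_topology, banach}"
  assumes y: "has_density t y g" and s: "0 \<le> s" "s \<le> h" "h \<le> t"
  shows "norm (y s - y 0) \<le> (LINT r:{0..h}|lborel. norm (g r))"
proof -
  have si: "set_integrable lborel {0..c} (\<lambda>r. g r)" for c
    unfolding set_integrable_def using has_density_integrable[OF y] by (intro integrable_mult_indicator) auto
  have "norm (y s - y 0) = norm (LINT r:{0..s}|lborel. g r)"
    using has_density_eq[OF y, of s] s by simp
  also have "\<dots> \<le> (LINT r:{0..s}|lborel. norm (g r))"
    using si by (rule set_integral_norm_bound)
  also have "\<dots> \<le> (LINT r:{0..h}|lborel. norm (g r))"
    unfolding set_lebesgue_integral_def using s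
    by (intro integral_mono set_integrable_norm[OF si, unfolded set_integrable_def]) (auto simp: indicator_def)
  finally show ?thesis .
qed

lemma has_density_shift:
  fixes g :: "real \<Rightarrow> 'a::{second_countable_topology, banach}"
  assumes y: "has_density t y g" and h: "0 \<le> h" "h \<le> t"
  shows "has_density (t - h) (\<lambda>s. y (s + h)) (\<lambda>s. g (s + h))"
  unfolding has_density_def
proof (intro conjI ballI)
  have g: "integrable lborel g" by (rule has_density_integrable[OF y])
  then show "integrable lborel (\<lambda>s. g (s + h))"
    using lborel_integrable_real_affine[OF g, of 1 h] by (simp add: add.commute)
  have si: "set_integrable lborel {a..b} g" for a b
    unfolding set_integrable_def using g by (intro integrable_mult_indicator) auto
  fix s assume "s \<in> {0..t - h}"
  then have s: "0 \<le> s" "s + h \<le> t" by auto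
  have "(LINT r:{0..s}|lborel. g (r + h)) = (LINT r:{h..s + h}|lborel. g r)"
    unfolding set_lebesgue_integral_def
    by (subst lborel_integral_real_affine[of 1 _ h])
       (auto simp: indicator_def add.commute intro!: Bochner_Integration.integral_cong)
  moreover have "(LINT r:{0..s + h}|lborel. g r) = (LINT r:{0..h}|lborel. g r) + (LINT r:{h..s + h}|lborel. g r)"
  proof -
    have "(LINT r:{0..s + h}|lborel. g r) = (LINT r:{0..h} \<union> {h..s + h}|lborel. g r)"
      using s h by (simp add: ivl_disj_un_two_touch)
    also have "\<dots> = (LINT r:{0..h}|lborel. g r) + (LINT r:{h..s + h}|lborel. g r)"
    proof (rule set_integral_Un_AE)
      show "AE r in lborel. \<not> (r \<in> {0..h} \<and> r \<in> {h..s + h})"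
        using AE_lborel_singleton[of h] by eventually_elim auto
    qed (use si in auto)
    finally show ?thesis .
  qed
  ultimately show "y (s + h) = y (0 + h) + (LINT r:{0..s}|lborel. g (r + h))"
    using has_density_eq[OF y, of "s + h"] has_density_eq[OF y, of h] s h by simp
qed

text \<open>Change of time with density \<open>w\<close>: pushing the measure \<open>w ds\<close> forward along \<open>\<tau> s = \<integral>\<^sub>0\<^sup>s w\<close> gives back
  Lebesgue measure, so no differentiability of \<open>\<tau>\<close> is needed to change variables.\<close>

lemma time_change:
  fixes w :: "real \<Rightarrow> real"
  assumes wm: "w \<in> borel_measurable borel" and k: "0 < k" "\<And>s. k \<le> w s"
    and w1: "integrable lborel (\<lambda>s. w s - 1)" "\<And>s. s \<notin> {0..t} \<Longrightarrow> w s = 1"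
      "(LINT s|lborel. w s - 1) = 0" and t: "0 \<le> t"
  obtains \<sigma> \<tau> :: "real \<Rightarrow> real"
  where "\<And>s. \<sigma> (\<tau> s) = s" "\<And>s. \<tau> (\<sigma> s) = s" "strict_mono \<tau>" "strict_mono \<sigma>"
    "continuous_on UNIV \<tau>" "continuous_on UNIV \<sigma>" "\<tau> 0 = 0" "\<tau> t = t"
    "distr (density lborel (\<lambda>s. ennreal (w s))) borel \<tau> = lborel"
proof -
  \<comment> \<open>\<open>w\<close> is 1 outside \<open>{0..t}\<close> and so not integrable on the
    line; its deviation from 1 is, which gives \<open>\<tau>\<close> globally as the identity plus
    an integral.\<close>
  define D where "D = (\<lambda>s. w s - 1)"
  have D: "integrable lborel D" using w1(1) by (simp add: D_def)
  have Dsi: "set_integrable lborel A D" if "A \<in> sets borel" for A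
    unfolding set_integrable_def using D that by (intro integrable_mult_indicator) auto
  define \<tau> where "\<tau> = (\<lambda>s. s + (LINT r:{0..s}|lborel. D r))"
  have \<tau>': "\<tau> s = s + (LINT r:{..s}|lborel. D r)" for s
    unfolding \<tau>_def set_lebesgue_integral_def using w1(2)
    by (auto simp: D_def indicator_def intro!: Bochner_Integration.integral_cong)
  have wsi: "set_integrable lborel {a<..b} w" and wint: "(LINT r:{a<..b}|lborel. w r) = \<tau> b - \<tau> a"
    if "a \<le> b" for a b
  proof -
    have one: "set_integrable lborel {a<..b} (\<lambda>_. 1::real)"
      by (rule set_integrable_subset[OF borel_integrable_atLeastAtMost'[of a b]]) (auto intro: continuous_intros)
    have "w = (\<lambda>r. D r + 1)" by (simp add: D_def)
    then show "set_integrable lborel {a<..b} w"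
      using Dsi[of "{a<..b}"] one by simp
    have "(LINT r:{a<..b}|lborel. w r) = (LINT r:{a<..b}|lborel. D r) + (LINT r:{a<..b}|lborel. 1)"
      using Dsi[of "{a<..b}"] one by (subst \<open>w = _\<close>) (rule set_integral_add, auto)
    also have "(LINT r:{a<..b}|lborel. 1) = b - a"
      using that by (simp add: set_integral_const)
    also have "(LINT r:{a<..b}|lborel. D r) = (LINT r:{..b}|lborel. D r) - (LINT r:{..a}|lborel. D r)"
    proof -
      have "(LINT r:{..b}|lborel. D r) = (LINT r:{..a} \<union> {a<..b}|lborel. D r)"
        using that by (simp add: ivl_disj_un)
      also have "\<dots> = (LINT r:{..a}|lborel. D r) + (LINT r:{a<..b}|lborel. D r)"
        by (intro set_integral_Un Dsi) auto
      finally show ?thesis by simp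
    qed
    finally show "(LINT r:{a<..b}|lborel. w r) = \<tau> b - \<tau> a"
      by (simp add: \<tau>')
  qed
  have "strict_mono \<tau>"
  proof (rule strict_monoI)
    fix a b :: real assume ab: "a < b"
    have "(LINT r:{a<..b}|lborel. k) \<le> (LINT r:{a<..b}|lborel. w r)"
    proof (rule set_integral_mono)
      show "set_integrable lborel {a<..b} (\<lambda>_. k)"
        by (rule set_integrable_subset[OF borel_integrable_atLeastAtMost'[of a b]]) (auto intro: continuous_intros)
    qed (use k ab in \<open>auto intro: wsi\<close>)
    then have "k * (b - a) \<le> \<tau> b - \<tau> a"
      using ab by (simp add: wint set_integral_const mult.commute)
    moreover have "0 < k * (b - a)" using k ab by simp
    ultimately show "\<tau> a < \<tau> b" by linarith
  qed
  have cont: "continuous_on UNIV \<tau>"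
    unfolding \<tau>_def by (intro continuous_intros continuous_on_integral_Icc D)
  have low: "\<tau> s = s" if "s \<le> 0" for s
    using that lborel_integral_singleton[of 0 D] by (cases "s = 0") (simp_all add: \<tau>_def set_lebesgue_integral_def)
  \<comment> \<open>Here the zero total of \<open>w - 1\<close> enters: \<open>\<tau>\<close> is the
    identity on both sides of \<open>{0..t}\<close>, hence unbounded in both directions and
    onto.\<close>
  have high: "\<tau> s = s" if "t \<le> s" for s
  proof -
    have "(LINT r:{..s}|lborel. D r) = integral\<^sup>L lborel D"
      unfolding set_lebesgue_integral_def using w1(2) that
      by (auto simp: D_def indicator_def intro!: Bochner_Integration.integral_cong)
    then show ?thesis using w1(3) by (simp add: \<tau>' D_def)
  qed
  have "surj \<tau>"
    unfolding surj_def
  proof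
    fix v
    have "\<exists>s. min v 0 \<le> s \<and> s \<le> max v t \<and> \<tau> s = v"
      using t by (intro IVT') (auto simp: low high intro: continuous_on_subset[OF cont])
    then show "\<exists>s. v = \<tau> s" by metis
  qed
  then have bij: "bij \<tau>"
    using strict_mono_imp_inj_on[OF \<open>strict_mono \<tau>\<close>] by (simp add: bij_def)
  define \<sigma> where "\<sigma> = inv \<tau>"
  have st: "\<sigma> (\<tau> s) = s" "\<tau> (\<sigma> s) = s" for s
    using bij by (simp_all add: \<sigma>_def bij_is_inj bij_is_surj surj_f_inv_f)
  have "strict_mono \<sigma>"
    using \<open>strict_mono \<tau>\<close> st by (metis strict_mono_def linorder_less_linear order_less_asym)
  have "continuous_on UNIV \<sigma>"
  proof (rule continuous_onI_mono)
    have "range \<sigma> = UNIV" using st(1) by (metis surj_def)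
    then show "open (range \<sigma>)" by simp
    show "\<sigma> a \<le> \<sigma> b" if "a \<le> b" for a b
      using \<open>strict_mono \<sigma>\<close> that by (simp add: strict_mono_less_eq)
  qed
  \<comment> \<open>It suffices to compare open intervals: the preimage of \<open>box l u\<close> is
    the interval from \<open>\<sigma> l\<close> to \<open>\<sigma> u\<close>, whose mass under
    \<open>w\<close> is the increment of \<open>\<tau>\<close>, that is
    \<open>u - l\<close>.\<close>
  moreover have "lborel = distr (density lborel (\<lambda>s. ennreal (w s))) borel \<tau>"
  proof (rule lborel_eqI)
    fix l u :: real assume "\<And>b. b \<in> Basis \<Longrightarrow> l \<bullet> b \<le> u \<bullet> b"
    then have lu: "l \<le> u" by simp
    then have \<sigma>lu: "\<sigma> l \<le> \<sigma> u"
      using \<open>strict_mono \<sigma>\<close> by (simp add: strict_mono_less_eq)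
    have \<tau>m: "\<tau> \<in> borel_measurable borel"
      using cont by (rule borel_measurable_continuous_onI)
    have pre: "\<tau> -` box l u = {\<sigma> l<..<\<sigma> u}"
    proof -
      have "l < \<tau> s \<longleftrightarrow> \<sigma> l < s" "\<tau> s < u \<longleftrightarrow> s < \<sigma> u" for s
        using strict_mono_less[OF \<open>strict_mono \<tau>\<close>, of "\<sigma> l" s]
          strict_mono_less[OF \<open>strict_mono \<tau>\<close>, of s "\<sigma> u"] by (simp_all add: st)
      then show ?thesis by auto
    qed
    have "emeasure (distr (density lborel (\<lambda>s. ennreal (w s))) borel \<tau>) (box l u)
        = (\<integral>\<^sup>+ s. ennreal (w s) * indicator {\<sigma> l<..<\<sigma> u} s \<partial>lborel)"
      using wm \<tau>m by (simp add: emeasure_distr emeasure_density pre del: box_real)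
    also have "\<dots> = (\<integral>\<^sup>+ s. ennreal (indicator {\<sigma> l<..\<sigma> u} s *\<^sub>R w s) \<partial>lborel)"
    proof (rule nn_integral_cong_AE)
      show "AE s in lborel. ennreal (w s) * indicator {\<sigma> l<..<\<sigma> u} s
          = ennreal (indicator {\<sigma> l<..\<sigma> u} s *\<^sub>R w s)"
        using AE_lborel_singleton[of "\<sigma> u"] by eventually_elim (auto simp: indicator_def)
    qed
    also have "\<dots> = ennreal (\<tau> (\<sigma> u) - \<tau> (\<sigma> l))"
    proof -
      have "0 \<le> w s" for s using k(1) k(2)[of s] by linarith
      then show ?thesis
        using wsi[OF \<sigma>lu] wint[OF \<sigma>lu]
        by (subst nn_integral_eq_integral) (auto simp: set_integrable_def set_lebesgue_integral_def)
    qed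
    finally show "emeasure (distr (density lborel (\<lambda>s. ennreal (w s))) borel \<tau>) (box l u)
        = (\<Prod>b\<in>Basis. (u - l) \<bullet> b)"
      by (simp add: st)
  qed simp
  ultimately show thesis
    using st \<open>strict_mono \<tau>\<close> \<open>strict_mono \<sigma>\<close> cont low[of 0] high[of t] by (intro that[of \<sigma> \<tau>]) simp_all
qed

section \<open>Lower semicontinuity and subdifferentials\<close>

lemma lsc_eventually:
  assumes "lsc f" "c < f x"
  shows "\<forall>\<^sub>F z in nhds x. c < f z"
proof -
  have "c < Liminf (at x) f"
    using assms unfolding lsc_def by (meson less_le_trans)
  then have "\<forall>\<^sub>F z in at x. c < f z"
    by (rule less_LiminfD)
  with assms(2) show ?thesis
    by (auto simp: eventually_at_filter elim: eventually_mono)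
qed

text \<open>Strict separation of the epigraph, closed because a finite convex function is
  continuous, from the point \<open>e\<close> below the graph at \<open>u\<close>. The graph point
  above \<open>u\<close> lies on the other side, so the hyperplane is not vertical and can be solved
  for the last coordinate.\<close>

lemma convex_affine_minorant:
  fixes f :: "'a::euclidean_space \<Rightarrow> real"
  assumes f: "convex_on UNIV f" and e: "0 < e"
  obtains c p where "\<And>v. c + p \<bullet> v \<le> f v" "f u - e < c + p \<bullet> u"
proof -
  have "continuous_on UNIV f"
    using f by (rule convex_on_continuous[OF open_UNIV])
  then have "continuous_on UNIV (\<lambda>z::'a \<times> real. f (fst z))"
    by (rule continuous_on_compose2) (auto intro: continuous_intros)
  then have "closed (epigraph UNIV f)"
    by (simp add: epigraph_def closed_Collect_le continuous_on_snd)
  moreover have "convex (epigraph UNIV f)"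
    using f by (simp add: convex_epigraph)
  moreover have "(u, f u - e) \<notin> epigraph UNIV f"
    using e by (simp add: epigraph_def)
  ultimately have "\<exists>a b. a \<bullet> (u, f u - e) < b \<and> (\<forall>z\<in>epigraph UNIV f. b < a \<bullet> z)"
    by (intro separating_hyperplane_closed_point)
  then obtain a b where ab: "a \<bullet> (u, f u - e) < b" "\<And>z. z \<in> epigraph UNIV f \<Longrightarrow> b < a \<bullet> z"
    by metis
  obtain q r where a: "a = (q, r)" by (cases a)
  have u: "q \<bullet> u + r * (f u - e) < b"
    using ab(1) by (simp add: a)
  have epi: "b < q \<bullet> v + r * f v" for v
    using ab(2)[of "(v, f v)"] by (simp add: a epigraph_def)
  have "0 < r * e"
    using u epi[of u] by (simp add: algebra_simps)
  then have r: "0 < r"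
    using e by (simp add: zero_less_mult_iff)
  show thesis
  proof (rule that[of "b / r" "- q /\<^sub>R r"])
    show "b / r + (- q /\<^sub>R r) \<bullet> v \<le> f v" for v
      using epi[of v] r by (simp add: field_simps inner_commute)
    show "f u - e < b / r + (- q /\<^sub>R r) \<bullet> u"
      using u r by (simp add: field_simps inner_commute)
  qed
qed

lemma Liminf_le_of_filterlim:
  fixes f :: "'a \<Rightarrow> 'b::complete_linorder"
  assumes g: "filterlim g F G" "G \<noteq> bot" and le: "\<forall>\<^sub>F i in G. f (g i) \<le> r"
  shows "Liminf F f \<le> r"
proof (rule ccontr)
  assume "\<not> Liminf F f \<le> r"
  then have "\<forall>\<^sub>F z in F. r < f z"
    by (intro less_LiminfD) simp
  then have "\<forall>\<^sub>F i in G. r < f (g i)"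
    by (rule filterlim_iff[THEN iffD1, OF g(1), rule_format])
  with le have "\<forall>\<^sub>F i in G. False"
    by eventually_elim simp
  with g(2) show False by simp
qed

text \<open>The difference quotient is cleared once and for all; \<open>z' = z\<close> is included,
  and the restriction to finite values keeps the arithmetic in the reals.\<close>

lemma subdifferential_lower_bound:
  assumes p: "p \<in> subdifferential F z" and v: "F z = ereal v" and e: "0 < e"
  obtains d where "0 < d"
    "\<And>z' v'. norm (z' - z) < d \<Longrightarrow> F z' = ereal v' \<Longrightarrow> v + p \<bullet> (z' - z) - e * norm (z' - z) \<le> v'"
proof -
  have "0 \<le> Liminf (at z) (\<lambda>z'. (F z' - F z - ereal (p \<bullet> (z' - z))) / ereal (norm (z' - z)))"
    using p by (auto simp: subdifferential_def split: if_splits)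
  then have "\<forall>\<^sub>F z' in at z. ereal (- e) < (F z' - F z - ereal (p \<bullet> (z' - z))) / ereal (norm (z' - z))"
    using e by (intro less_LiminfD) (auto elim: less_le_trans[rotated])
  then obtain d where d: "0 < d" "\<And>z'. z' \<noteq> z \<Longrightarrow> dist z' z < d \<Longrightarrow>
      ereal (- e) < (F z' - F z - ereal (p \<bullet> (z' - z))) / ereal (norm (z' - z))"
    by (auto simp: eventually_at)
  show thesis
  proof (rule that[OF d(1)])
    fix z' v' assume z': "norm (z' - z) < d" "F z' = ereal v'"
    show "v + p \<bullet> (z' - z) - e * norm (z' - z) \<le> v'"
    proof (cases "z' = z")
      case True
      then show ?thesis using z' v by simp
    next
      case False
      then have n: "0 < norm (z' - z)" by simp
      have "- e < (v' - v - p \<bullet> (z' - z)) / norm (z' - z)"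
        using d(2)[OF False] z' v n by (simp add: dist_norm)
      then have "- e * norm (z' - z) < v' - v - p \<bullet> (z' - z)"
        using n by (simp only: pos_less_divide_eq)
      then show ?thesis by simp
    qed
  qed
qed

lemma ennreal_add_leE:
  assumes "a + b \<le> ennreal c" "0 \<le> c"
  obtains a' b' where "a = ennreal a'" "b = ennreal b'" "0 \<le> a'" "0 \<le> b'" "a' + b' \<le> c"
proof -
  have "a \<noteq> \<infinity>" "b \<noteq> \<infinity>"
    using assms(1) by (auto simp: top_unique)
  then obtain a' b' where *: "a = ennreal a'" "b = ennreal b'" "0 \<le> a'" "0 \<le> b'"
    by (metis ennreal_cases infinity_ennreal_def)
  moreover have "a' + b' \<le> c"
    using assms * by (simp flip: ennreal_plus)
  ultimately show thesis by (rule that)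
qed

text \<open>Only small \<open>h\<close> need the linear bound: beyond \<open>h0\<close> the
  denominator is bounded away from zero, and the numerator is bounded by compactness.\<close>

lemma bounded_difference_quotients:
  fixes y :: "real \<Rightarrow> 'a::real_normed_vector"
  assumes y: "continuous_on {0..t} y" and h0: "0 < h0" "\<And>h. 0 < h \<Longrightarrow> h \<le> h0 \<Longrightarrow> norm (y h - x) \<le> K * h"
  shows "bounded {(y h - x) /\<^sub>R h | h. 0 < h \<and> h \<le> (t::real)}"
proof -
  have "bounded (y ` {0..t})"
    using y by (intro compact_imp_bounded compact_continuous_image) auto
  then have "\<exists>b. \<forall>s\<in>{0..t}. norm (y s) \<le> b" by (simp add: bounded_iff)
  then obtain b where b: "\<And>s. s \<in> {0..t} \<Longrightarrow> norm (y s) \<le> b" by metis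
  have "norm ((y h - x) /\<^sub>R h) \<le> max K ((b + norm x) / h0)" if h: "0 < h" "h \<le> t" for h
  proof (cases "h \<le> h0")
    case True
    have "norm ((y h - x) /\<^sub>R h) = norm (y h - x) / h" using h(1) by (simp add: divide_inverse mult.commute)
    also have "\<dots> \<le> K" using h0(2)[OF h(1) True] h(1) by (simp add: pos_divide_le_eq)
    finally show ?thesis by simp
  next
    case False
    have "norm ((y h - x) /\<^sub>R h) = norm (y h - x) / h" using h(1) by (simp add: divide_inverse mult.commute)
    also have "\<dots> \<le> (b + norm x) / h0"
    proof (rule frac_le)
      show "norm (y h - x) \<le> b + norm x"
        using h b[of h] norm_triangle_ineq4[of "y h" x] by simp
      then show "0 \<le> b + norm x" by (rule order_trans[OF norm_ge_zero])
    qed (use h0(1) False in auto)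
    finally show ?thesis by simp
  qed
  then show ?thesis unfolding bounded_iff by blast
qed

section \<open>The Bolza problem\<close>

locale lagrangian =
  fixes L :: "real ^ 'n \<Rightarrow> real ^ 'n \<Rightarrow> real" and \<Theta> :: "real ^ 'n \<Rightarrow> real"
  assumes L_nonneg: "\<And>x u. 0 \<le> L x u"
    and L_lsc: "lsc (\<lambda>(x, u). ereal (L x u))"
    and L_convex: "\<And>x. convex_on UNIV (L x)"
    and Theta_superlinear: "filterlim (\<lambda>u. \<Theta> u / norm u) at_top at_infinity"
    and L_ge_Theta: "\<And>x u. \<Theta> u \<le> L x u"
begin

lemma L_eventually_greater:
  assumes "c < L x u"
  shows "\<forall>\<^sub>F z in nhds (x, u). c < L (fst z) (snd z)"
  using lsc_eventually[OF L_lsc, of "ereal c" "(x, u)"] assms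
  by (simp add: case_prod_beta)

lemma L_borel: "(\<lambda>z. L (fst z) (snd z)) \<in> borel_measurable borel"
proof (rule borel_measurableI_greater)
  fix c
  have "open {z. c < L (fst z) (snd z)}"
    unfolding open_contains_ball
  proof (intro ballI)
    fix z assume "z \<in> {z. c < L (fst z) (snd z)}"
    then show "\<exists>e>0. ball z e \<subseteq> {z. c < L (fst z) (snd z)}"
      using L_eventually_greater[of c "fst z" "snd z"]
      by (auto simp: eventually_nhds_metric subset_iff dist_commute)
  qed
  then show "{z \<in> space borel. c < L (fst z) (snd z)} \<in> sets borel" by simp
qed

text \<open>Superlinear growth as an affine bound of any slope, uniform in the position. Inside the
  radius where the slope is not yet reached, nonnegativity of \<open>L\<close> suffices with
  \<open>C = k * \<bar>R\<bar>\<close>.\<close>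

lemma L_growth:
  assumes "0 \<le> k"
  obtains C where "0 \<le> C" "\<And>x v. k * norm v - C \<le> L x v"
proof -
  have "\<forall>\<^sub>F u in at_infinity. k \<le> \<Theta> u / norm u"
    using Theta_superlinear by (simp add: filterlim_at_top)
  then obtain R where R: "\<And>u. R \<le> norm u \<Longrightarrow> k \<le> \<Theta> u / norm u"
    by (auto simp: eventually_at_infinity)
  show thesis
  proof (rule that[of "k * \<bar>R\<bar>"])
    show "0 \<le> k * \<bar>R\<bar>" using assms by simp
    fix x v
    show "k * norm v - k * \<bar>R\<bar> \<le> L x v"
    proof (cases "R \<le> norm v \<and> v \<noteq> 0")
      case True
      with R[of v] have "k * norm v \<le> \<Theta> v" by (simp add: pos_le_divide_eq)
      moreover have "0 \<le> k * \<bar>R\<bar>" using assms by simp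
      ultimately show ?thesis using L_ge_Theta[of v x] by simp
    next
      case False
      then have "norm v \<le> \<bar>R\<bar>" by auto
      then have "k * norm v \<le> k * \<bar>R\<bar>" using assms by (rule mult_left_mono)
      then show ?thesis using L_nonneg[of x v] by simp
    qed
  qed
qed

text \<open>Superlinearity disposes of large velocities, lower semicontinuity and compactness of the others.\<close>

lemma L_affine_minorant_nearby:
  assumes min: "\<And>v. c + p \<bullet> v \<le> L x v" and e: "0 < e"
  obtains d where "0 < d" "\<And>y v. dist y x < d \<Longrightarrow> c + p \<bullet> v - e \<le> L y v"
proof -
  \<comment> \<open>The slope exceeds \<open>norm p\<close> by 1, so velocities violating the
    minorant stay bounded.\<close>
  obtain C where C: "0 \<le> C" "\<And>y v. (norm p + 1) * norm v - C \<le> L y v"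
    using L_growth[of "norm p + 1"] by auto
  have "\<exists>d>0. \<forall>y v. dist y x < d \<longrightarrow> c + p \<bullet> v - e \<le> L y v"
  proof (rule ccontr)
    assume "\<not> ?thesis"
    then have "\<exists>y v. dist y x < inverse (real (Suc n)) \<and> L y v < c + p \<bullet> v - e" for n
      by (metis inverse_positive_iff_positive not_le of_nat_0_less_iff zero_less_Suc)
    then obtain Y V where Y: "\<And>n. dist (Y n) x < inverse (real (Suc n))"
      and V: "\<And>n. L (Y n) (V n) < c + p \<bullet> V n - e"
      by metis
    have "norm (V n) \<le> C + c" for n
    proof -
      have "p \<bullet> V n \<le> norm p * norm (V n)" by (rule norm_cauchy_schwarz)
      then show ?thesis using C(2)[of "V n" "Y n"] V[of n] e by (simp add: algebra_simps)
    qed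
    then have "bounded (range V)" by (auto simp: bounded_iff)
    then obtain v r where r: "strict_mono r" "(V \<circ> r) \<longlonglongrightarrow> v"
      using bounded_imp_convergent_subsequence by blast
    have "Y \<longlonglongrightarrow> x"
    proof (rule metric_tendsto_imp_tendsto[OF LIMSEQ_inverse_real_of_nat])
      show "\<forall>\<^sub>F n in sequentially. dist (Y n) x \<le> dist (inverse (real (Suc n))) 0"
        using Y by (intro always_eventually) (simp add: less_imp_le)
    qed
    then have "(\<lambda>n. (Y (r n), V (r n))) \<longlonglongrightarrow> (x, v)"
      using r by (intro tendsto_Pair) (auto simp: o_def dest: LIMSEQ_subseq_LIMSEQ[of Y x r])
    \<comment> \<open>One half of \<open>e\<close> pays for lower semicontinuity at
      \<open>(x, v)\<close>, the other for replacing \<open>v\<close> by \<open>V (r n)\<close> in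
      the linear term.\<close>
    moreover have "c + p \<bullet> v - e / 2 < L x v"
      using min[of v] e by simp
    ultimately have "\<forall>\<^sub>F n in sequentially. c + p \<bullet> v - e / 2 < L (Y (r n)) (V (r n))"
      using L_eventually_greater[of "c + p \<bullet> v - e / 2" x v] by (fastforce simp: filterlim_iff)
    moreover have "\<forall>\<^sub>F n in sequentially. p \<bullet> V (r n) < p \<bullet> v + e / 2"
    proof (rule order_tendstoD)
      show "(\<lambda>n. p \<bullet> V (r n)) \<longlonglongrightarrow> p \<bullet> v" using r(2) by (intro tendsto_intros) (simp add: o_def)
    qed (use e in simp)
    ultimately have "\<forall>\<^sub>F n in sequentially. False"
    proof eventually_elim
      case (elim n)
      then show False using V[of "r n"] by simp
    qed
    then show False by simp
  qed
  with that show thesis by blast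
qed

section \<open>The action of a curve\<close>

definition action :: "real \<Rightarrow> (real \<Rightarrow> real ^ 'n) \<Rightarrow> (real \<Rightarrow> real ^ 'n) \<Rightarrow> ennreal"
  where "action t y g = (\<integral>\<^sup>+ s\<in>{0..t}. ennreal (L (y s) (g s)) \<partial>lborel)"

text \<open>\<open>y\<close> is arbitrary outside \<open>{a..b}\<close>, so it is cut off before
  being composed with the Borel function \<open>L\<close>.\<close>

lemma L_curve_borel:
  fixes y g :: "real \<Rightarrow> real ^ 'n"
  assumes y: "continuous_on {a..b} y" and g: "g \<in> borel_measurable borel"
  shows "(\<lambda>s. L (y s) (g s) * indicator {a..b} s) \<in> borel_measurable borel"
proof -
  have y': "(\<lambda>s. indicator {a..b} s *\<^sub>R y s) \<in> borel_measurable borel"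
    using y by (intro borel_measurable_continuous_on_indicator) auto
  have "(\<lambda>s. L (indicator {a..b} s *\<^sub>R y s) (g s) * indicator {a..b} s) \<in> borel_measurable borel"
    using measurable_compose[OF measurable_Pair[OF y' g], of "\<lambda>z. L (fst z) (snd z)" borel] L_borel
    by (simp add: borel_prod)
  moreover have "(\<lambda>s. L (indicator {a..b} s *\<^sub>R y s) (g s) * indicator {a..b} s)
      = (\<lambda>s. L (y s) (g s) * indicator {a..b} s)"
    by (auto simp: indicator_def)
  ultimately show ?thesis by simp
qed

lemma action_eq: "action t y g = (\<integral>\<^sup>+ s. ennreal (L (y s) (g s) * indicator {0..t} s) \<partial>lborel)"
  unfolding action_def by (rule nn_integral_set_ennreal)

lemma action_real:
  assumes y: "continuous_on {0..t} y" and g: "g \<in> borel_measurable borel"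
    and A: "action t y g \<le> ennreal A" "0 \<le> A"
  shows "set_integrable lborel {0..t} (\<lambda>s. L (y s) (g s))" "(LINT s:{0..t}|lborel. L (y s) (g s)) \<le> A"
proof -
  have int: "integrable lborel (\<lambda>s. L (y s) (g s) * indicator {0..t} s)"
  proof (rule integrableI_nonneg)
    show "(\<lambda>s. L (y s) (g s) * indicator {0..t} s) \<in> borel_measurable lborel"
      using L_curve_borel[OF y g] by simp
    show "(\<integral>\<^sup>+ s. ennreal (L (y s) (g s) * indicator {0..t} s) \<partial>lborel) < \<infinity>"
      using A(1) unfolding action_eq by (metis ennreal_less_top infinity_ennreal_def le_less_trans)
  qed (simp add: L_nonneg)
  then show "set_integrable lborel {0..t} (\<lambda>s. L (y s) (g s))"
    unfolding set_integrable_def by (simp add: mult.commute)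
  have "ennreal (LINT s|lborel. L (y s) (g s) * indicator {0..t} s) \<le> ennreal A"
    using A(1) nn_integral_eq_integral[OF int] unfolding action_eq by (simp add: L_nonneg)
  then show "(LINT s:{0..t}|lborel. L (y s) (g s)) \<le> A"
    using A(2) unfolding set_lebesgue_integral_def by (simp add: mult.commute)
qed

text \<open>Integrated over \<open>{0..h}\<close>, the growth bound controls the length of the arc,
  hence the displacement at every intermediate time and not only at \<open>h\<close>.\<close>

lemma action_growth:
  assumes y: "has_density t y g" and h: "0 \<le> h" "h \<le> t" and A: "action h y g \<le> ennreal A" "0 \<le> A"
    and k: "0 \<le> k" "\<And>x v. k * norm v - C \<le> L x v"
    and s: "0 \<le> s" "s \<le> h"
  shows "k * norm (y s - y 0) \<le> A + C * h"
proof -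
  have g: "integrable lborel g" by (rule has_density_integrable[OF y])
  have yc: "continuous_on {0..h} y"
    using has_density_continuous_on[OF y] by (rule continuous_on_subset) (use h in auto)
  have si: "set_integrable lborel {0..h} (\<lambda>r. norm (g r))"
    unfolding set_integrable_def using g by (intro integrable_mult_indicator) auto
  have cs: "set_integrable lborel {0..h} (\<lambda>r. C)"
    by (intro borel_integrable_atLeastAtMost' continuous_intros)
  note re = action_real[OF yc borel_measurable_integrable[OF g, simplified] A]
  have "k * norm (y s - y 0) \<le> k * (LINT r:{0..h}|lborel. norm (g r))"
    using has_density_displacement[OF y s h(2)] k(1) by (rule mult_left_mono)
  also have "\<dots> - C * h = (LINT r:{0..h}|lborel. k * norm (g r) - C)"
    using si cs h(1) by (subst set_integral_diff) (auto simp: set_integral_const)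
  also have "\<dots> \<le> (LINT r:{0..h}|lborel. L (y r) (g r))"
    using si cs k(2) by (intro set_integral_mono re(1)) auto
  also have "\<dots> \<le> A" by (rule re)
  finally show ?thesis by simp
qed

text \<open>This takes the place of Jensen's inequality: an affine function of the velocity
  integrates to an expression in \<open>h\<close> and the endpoints alone.\<close>

lemma action_affine_minorant:
  assumes y: "has_density t y g" and h: "0 \<le> h" "h \<le> t" and A: "action h y g \<le> ennreal A" "0 \<le> A"
    and min: "\<And>s v. 0 \<le> s \<Longrightarrow> s \<le> h \<Longrightarrow> c + p \<bullet> v \<le> L (y s) v"
  shows "c * h + p \<bullet> (y h - y 0) \<le> A"
proof -
  have g: "integrable lborel g" by (rule has_density_integrable[OF y])
  have yc: "continuous_on {0..h} y"
    using has_density_continuous_on[OF y] by (rule continuous_on_subset) (use h in auto)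
  have si: "set_integrable lborel {0..h} g"
    unfolding set_integrable_def using g by (intro integrable_mult_indicator) auto
  then have pi: "set_integrable lborel {0..h} (\<lambda>r. p \<bullet> g r)"
    unfolding set_integrable_def by (simp flip: inner_scaleR_right)
  have cs: "set_integrable lborel {0..h} (\<lambda>r. c)"
    by (intro borel_integrable_atLeastAtMost' continuous_intros)
  note re = action_real[OF yc borel_measurable_integrable[OF g, simplified] A]
  have "p \<bullet> (y h - y 0) = (LINT r:{0..h}|lborel. p \<bullet> g r)"
    using has_density_eq[OF y h] si
    unfolding set_lebesgue_integral_def set_integrable_def by (simp flip: inner_scaleR_right)
  then have "c * h + p \<bullet> (y h - y 0) = (LINT r:{0..h}|lborel. c + p \<bullet> g r)"
    using pi cs h(1) by (subst set_integral_add) (auto simp: set_integral_const)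
  also have "\<dots> \<le> (LINT r:{0..h}|lborel. L (y r) (g r))"
    using pi cs min by (intro set_integral_mono re(1)) auto
  also have "\<dots> \<le> A" by (rule re)
  finally show ?thesis .
qed

lemma action_split:
  assumes y: "has_density t y g" and h: "0 \<le> h" "h \<le> t"
  shows "action t y g = action (t - h) (\<lambda>s. y (s + h)) (\<lambda>s. g (s + h)) + action h y g"
proof -
  have g: "g \<in> borel_measurable borel"
    using has_density_integrable[OF y] by auto
  have meas: "(\<lambda>s. ennreal (L (y s) (g s) * indicator {a..b} s)) \<in> borel_measurable borel"
    if "0 \<le> a" "b \<le> t" for a b
  proof -
    have "continuous_on {a..b} y"
      using has_density_continuous_on[OF y] by (rule continuous_on_subset) (use that in auto)
    then show ?thesis using L_curve_borel[OF _ g] by auto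
  qed
  have "action (t - h) (\<lambda>s. y (s + h)) (\<lambda>s. g (s + h))
      = (\<integral>\<^sup>+ s. ennreal (L (y s) (g s) * indicator {h..t} s) \<partial>lborel)"
    unfolding action_eq using meas[of h t] h
    by (subst nn_integral_real_affine[of _ 1 h])
       (auto simp: indicator_def add.commute intro!: nn_integral_cong)
  then have "action (t - h) (\<lambda>s. y (s + h)) (\<lambda>s. g (s + h)) + action h y g
      = (\<integral>\<^sup>+ s. ennreal (L (y s) (g s) * indicator {h..t} s) + ennreal (L (y s) (g s) * indicator {0..h} s) \<partial>lborel)"
    unfolding action_eq using meas[of h t] meas[of 0 h] h by (subst nn_integral_add) auto
  also have "\<dots> = action t y g"
    unfolding action_eq
  proof (rule nn_integral_cong_AE)
    show "AE s in lborel. ennreal (L (y s) (g s) * indicator {h..t} s) + ennreal (L (y s) (g s) * indicator {0..h} s)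
        = ennreal (L (y s) (g s) * indicator {0..t} s)"
      using AE_lborel_singleton[of h] by eventually_elim (use h in \<open>auto simp: indicator_def\<close>)
  qed
  finally show ?thesis ..
qed

lemma has_density_admissible: "has_density t y g \<Longrightarrow> y \<in> admissible t (y 0)"
  unfolding admissible_def using has_density_W11 by (intro CollectI conjI refl)

lemma Bolza_cost_action: "has_density t y g \<Longrightarrow> Bolza_cost L \<phi> t y = action t y g + \<phi> (y t)"
  unfolding action_def by (rule Bolza_cost_has_density)

lemma dynamic_programming:
  assumes y: "has_density t y g" and h: "0 \<le> h" "h \<le> t"
  shows "(INF z\<in>admissible (t - h) (y h). Bolza_cost L \<phi> (t - h) z) + action h y g \<le> Bolza_cost L \<phi> t y"
proof -
  note sh = has_density_shift[OF y h]
  have "(INF z\<in>admissible (t - h) (y h). Bolza_cost L \<phi> (t - h) z)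
      \<le> action (t - h) (\<lambda>s. y (s + h)) (\<lambda>s. g (s + h)) + \<phi> (y t)"
  proof (rule INF_lower2)
    show "(\<lambda>s. y (s + h)) \<in> admissible (t - h) (y h)"
      using has_density_admissible[OF sh] by simp
    show "Bolza_cost L \<phi> (t - h) (\<lambda>s. y (s + h)) \<le> action (t - h) (\<lambda>s. y (s + h)) (\<lambda>s. g (s + h)) + \<phi> (y t)"
      using Bolza_cost_action[OF sh, of \<phi>] by simp
  qed
  then have "(INF z\<in>admissible (t - h) (y h). Bolza_cost L \<phi> (t - h) z) + action h y g
      \<le> (action (t - h) (\<lambda>s. y (s + h)) (\<lambda>s. g (s + h)) + \<phi> (y t)) + action h y g"
    by (rule add_right_mono)
  also have "\<dots> = Bolza_cost L \<phi> t y"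
    unfolding Bolza_cost_action[OF y] action_split[OF y h] by (simp only: ac_simps)
  finally show ?thesis .
qed

text \<open>The competitor is \<open>y\<close> composed with the inverse of the time change
  \<open>\<tau>\<close>, so its velocity is that of \<open>y\<close> divided by \<open>w\<close>;
  substituting back multiplies the time element by \<open>w\<close>. Fixed endpoints keep the
  terminal cost.\<close>

lemma reparametrization:
  assumes y: "has_density t y g" and t: "0 \<le> t"
    and wm: "w \<in> borel_measurable borel" and k: "0 < k" "\<And>s. k \<le> w s"
    and w1: "integrable lborel (\<lambda>s. w s - 1)" "\<And>s. s \<notin> {0..t} \<Longrightarrow> w s = 1"
      "(LINT s|lborel. w s - 1) = 0"
  obtains z where "z \<in> admissible t (y 0)"
    "Bolza_cost L \<phi> t z = (\<integral>\<^sup>+ s\<in>{0..t}. ennreal (w s * L (y s) (g s /\<^sub>R w s)) \<partial>lborel) + \<phi> (y t)"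
proof -
  obtain \<sigma> \<tau> where st: "\<And>s. \<sigma> (\<tau> s) = s" "\<And>s. \<tau> (\<sigma> s) = s" and mono: "strict_mono \<tau>" "strict_mono \<sigma>"
    and cont: "continuous_on UNIV \<tau>" "continuous_on UNIV \<sigma>" and ends: "\<tau> 0 = 0" "\<tau> t = t"
    and push: "distr (density lborel (\<lambda>s. ennreal (w s))) borel \<tau> = lborel"
    by (rule time_change[OF wm k w1 t]) (assumption | rule that)+
  have w0: "0 < w s" for s using k(1) k(2)[of s] by linarith
  have ends': "\<sigma> 0 = 0" "\<sigma> t = t" using st(1)[of 0] st(1)[of t] ends by simp_all
  have \<tau>_le: "\<tau> s \<le> \<tau> r \<longleftrightarrow> s \<le> r" and \<sigma>_le: "\<sigma> s \<le> \<sigma> r \<longleftrightarrow> s \<le> r" for s r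
    using mono by (simp_all add: strict_mono_less_eq)
  have \<tau>m: "\<tau> \<in> borel_measurable borel" and \<sigma>m: "\<sigma> \<in> borel_measurable borel"
    using cont by (auto intro: borel_measurable_continuous_onI)
  have \<tau>m': "\<tau> \<in> measurable (density lborel (\<lambda>s. ennreal (w s))) borel"
    using \<tau>m by simp
  have g: "integrable lborel g" by (rule has_density_integrable[OF y])
  then have gm: "g \<in> borel_measurable borel" by auto
  define z where "z = (\<lambda>s. y (\<sigma> s))"
  define gz where "gz = (\<lambda>s. g (\<sigma> s) /\<^sub>R w (\<sigma> s))"
  have gzm: "gz \<in> borel_measurable borel"
    unfolding gz_def using gm wm \<sigma>m by measurable
  have z: "has_density t z gz"
    unfolding has_density_def
  proof (intro conjI ballI)
    have "integrable (distr (density lborel (\<lambda>s. ennreal (w s))) borel \<tau>) gz"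
      using w0 gzm wm \<tau>m g
      by (subst integrable_distr_eq[OF \<tau>m' gzm], subst integrable_density)
         (auto simp: gz_def st less_imp_le less_imp_neq[symmetric] intro!: AE_I2)
    then show "integrable lborel gz" by (simp only: push)
    fix s assume s: "s \<in> {0..t}"
    then have \<sigma>s: "0 \<le> \<sigma> s" "\<sigma> s \<le> t"
      using \<sigma>_le[of 0 s] \<sigma>_le[of s t] ends' by auto
    have "(LINT r:{0..s}|lborel. gz r)
        = (LINT r|distr (density lborel (\<lambda>s. ennreal (w s))) borel \<tau>. indicator {0..s} r *\<^sub>R gz r)"
      unfolding set_lebesgue_integral_def push ..
    also have "\<dots> = (LINT r|lborel. w r *\<^sub>R indicator {0..s} (\<tau> r) *\<^sub>R gz (\<tau> r))"
      using w0 gzm wm \<tau>m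
      by (subst integral_distr[OF \<tau>m'], simp, subst integral_density) (auto simp: less_imp_le intro!: AE_I2)
    also have "\<dots> = (LINT r:{0..\<sigma> s}|lborel. g r)"
      unfolding set_lebesgue_integral_def
    proof (rule Bochner_Integration.integral_cong[OF refl])
      fix r
      have "0 \<le> \<tau> r \<longleftrightarrow> 0 \<le> r" "\<tau> r \<le> s \<longleftrightarrow> r \<le> \<sigma> s"
        using \<tau>_le[of 0 r] \<tau>_le[of r "\<sigma> s"] by (simp_all add: ends st)
      then show "w r *\<^sub>R indicator {0..s} (\<tau> r) *\<^sub>R gz (\<tau> r) = indicator {0..\<sigma> s} r *\<^sub>R g r"
        using w0[of r] by (simp add: gz_def st indicator_def)
    qed
    finally show "z s = z 0 + (LINT r:{0..s}|lborel. gz r)"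
      using has_density_eq[OF y \<sigma>s] by (simp add: z_def ends')
  qed
  have zc: "continuous_on {0..t} z" by (rule has_density_continuous_on[OF z])
  have Lm: "(\<lambda>s. ennreal (L (z s) (gz s) * indicator {0..t} s)) \<in> borel_measurable borel"
    using L_curve_borel[OF zc gzm] by simp
  have "action t z gz = (\<integral>\<^sup>+ s. ennreal (L (z s) (gz s) * indicator {0..t} s)
      \<partial>distr (density lborel (\<lambda>s. ennreal (w s))) borel \<tau>)"
    unfolding action_eq push ..
  also have "\<dots> = (\<integral>\<^sup>+ s. ennreal (w s) * ennreal (L (z (\<tau> s)) (gz (\<tau> s)) * indicator {0..t} (\<tau> s)) \<partial>lborel)"
    using wm Lm measurable_compose[OF \<tau>m Lm]
    by (subst nn_integral_distr[OF \<tau>m'], simp, subst nn_integral_density) auto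
  also have "\<dots> = (\<integral>\<^sup>+ s\<in>{0..t}. ennreal (w s * L (y s) (g s /\<^sub>R w s)) \<partial>lborel)"
  proof (rule nn_integral_cong)
    fix s
    have "0 \<le> \<tau> s \<longleftrightarrow> 0 \<le> s" "\<tau> s \<le> t \<longleftrightarrow> s \<le> t"
      using \<tau>_le[of 0 s] \<tau>_le[of s t] by (simp_all add: ends)
    then show "ennreal (w s) * ennreal (L (z (\<tau> s)) (gz (\<tau> s)) * indicator {0..t} (\<tau> s))
        = ennreal (w s * L (y s) (g s /\<^sub>R w s)) * indicator {0..t} s"
      using w0[of s] L_nonneg by (simp add: z_def gz_def st indicator_def ennreal_mult less_imp_le)
  qed
  finally have "Bolza_cost L \<phi> t z = (\<integral>\<^sup>+ s\<in>{0..t}. ennreal (w s * L (y s) (g s /\<^sub>R w s)) \<partial>lborel) + \<phi> (y t)"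
    using Bolza_cost_action[OF z, of \<phi>] by (simp add: z_def ends')
  moreover have "z \<in> admissible t (y 0)"
    using has_density_admissible[OF z] by (simp add: z_def ends')
  ultimately show thesis by (intro that)
qed

section \<open>The value function and the supersolution property\<close>

definition inf_cost :: "(real ^ 'n \<Rightarrow> ennreal) \<Rightarrow> real \<Rightarrow> real ^ 'n \<Rightarrow> ennreal"
  where "inf_cost \<phi> t x = (INF y\<in>admissible t x. Bolza_cost L \<phi> t y)"

lemma value_function_inf_cost: "0 \<le> t \<Longrightarrow> value_function L \<phi> (t, x) = enn2ereal (inf_cost \<phi> t x)"
  by (simp add: value_function_def inf_cost_def)

lemma value_function_finite:
  assumes "(t, x) \<in> effective_domain (value_function L \<phi>)"
  obtains v where "0 \<le> t" "0 \<le> v" "inf_cost \<phi> t x = ennreal v"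
proof -
  have t: "0 \<le> t"
    using assms by (auto simp: effective_domain_def value_function_def split: if_splits)
  then have "inf_cost \<phi> t x \<noteq> \<infinity>"
    using assms by (auto simp: effective_domain_def value_function_inf_cost)
  then show thesis
    using t that by (metis ennreal_cases infinity_ennreal_def)
qed

lemma admissible_has_density:
  assumes "y \<in> admissible t x"
  obtains g where "has_density t y g" "y 0 = x"
  using assms by (auto simp: admissible_def elim: W11_has_density)

lemma dynamic_programming_real:
  assumes y: "has_density t y g" and h: "0 \<le> h" "h \<le> t"
    and c: "Bolza_cost L \<phi> t y \<le> ennreal c" "0 \<le> c"
  obtains w a where "0 \<le> w" "0 \<le> a" "value_function L \<phi> (t - h, y h) = ereal w"
    "action h y g = ennreal a" "w + a \<le> c"
proof -
  have "inf_cost \<phi> (t - h) (y h) + action h y g \<le> ennreal c"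
    using dynamic_programming[OF y h, of \<phi>] c(1) unfolding inf_cost_def by (rule order_trans)
  then obtain w a where "inf_cost \<phi> (t - h) (y h) = ennreal w" "action h y g = ennreal a"
      "0 \<le> w" "0 \<le> a" "w + a \<le> c"
    using c(2) by (rule ennreal_add_leE)
  then show thesis
    using h by (intro that[of w a]) (simp_all add: value_function_inf_cost enn2ereal_ennreal)
qed

text \<open>The costs of \<open>h\<^sup>2\<close>-minimizers are controlled well enough for a difference quotient, so the existence
  of minimizers is never needed.\<close>

lemma near_minimizer_bounds:
  assumes p: "(p_t, p_x) \<in> subdifferential (value_function L \<phi>) (t, x)" and t: "0 < t"
    and v: "inf_cost \<phi> t x = ennreal v" "0 \<le> v" and e: "0 < e" and \<rho>: "0 < \<rho>"
  obtains K h0 where "0 < h0" "h0 \<le> t"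
    "\<And>h y g. 0 < h \<Longrightarrow> h \<le> h0 \<Longrightarrow> has_density t y g \<Longrightarrow> y 0 = x \<Longrightarrow>
      Bolza_cost L \<phi> t y \<le> ennreal (v + h\<^sup>2) \<Longrightarrow>
      norm (y h - x) \<le> K * h \<and> (\<forall>s\<in>{0..h}. norm (y s - x) \<le> \<rho>) \<and>
      (\<exists>a\<ge>0. action h y g = ennreal a \<and>
        a \<le> h\<^sup>2 + p_t * h - p_x \<bullet> (y h - x) + e * (h + norm (y h - x)))"
proof -
  have V: "value_function L \<phi> (t, x) = ereal v"
    using t v by (simp add: value_function_inf_cost enn2ereal_ennreal)
  obtain d where d: "0 < d"
    "\<And>z' v'. norm (z' - (t, x)) < d \<Longrightarrow> value_function L \<phi> z' = ereal v' \<Longrightarrow>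
      v + (p_t, p_x) \<bullet> (z' - (t, x)) - e * norm (z' - (t, x)) \<le> v'"
    by (rule subdifferential_lower_bound[OF p V e]) (assumption | rule that)+
  \<comment> \<open>A crude localization has to come first, since the subgradient inequality holds
    only near \<open>(t, x)\<close>. The action is at most \<open>v + 1\<close> and
    \<open>C * h\<close> at most 1, so \<open>k * \<mu> = v + 2\<close> confines the arc to radius
    \<open>\<mu>\<close>.\<close>
  define \<mu> where "\<mu> = min \<rho> (d / 4)"
  have \<mu>: "0 < \<mu>" "\<mu> \<le> \<rho>" "\<mu> \<le> d / 4" using \<rho> d(1) by (auto simp: \<mu>_def)
  define k where "k = (v + 2) / \<mu>"
  have k: "0 < k" "k * \<mu> = v + 2" using v(2) \<mu>(1) by (simp_all add: k_def)
  obtain C where C: "0 \<le> C" "\<And>x v. k * norm v - C \<le> L x v"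
    using L_growth[of k] k(1) by auto
  \<comment> \<open>The subgradient bounds the action with coefficient \<open>norm p_x + e\<close>
    on the displacement. A slope larger by 1 leaves one copy of the displacement on the left, and
    the remaining terms give \<open>K\<close>.\<close>
  obtain C2 where C2: "0 \<le> C2" "\<And>x v. (norm p_x + e + 1) * norm v - C2 \<le> L x v"
    using L_growth[of "norm p_x + e + 1"] e by auto
  define h0 where "h0 = Min {1, 1 / (C + 1), d / 4, t}"
  have h0: "0 < h0" "h0 \<le> 1" "h0 \<le> 1 / (C + 1)" "h0 \<le> d / 4" "h0 \<le> t"
    using C(1) d(1) t by (simp_all add: h0_def)
  define K where "K = 1 + \<bar>p_t\<bar> + e + C2"
  show thesis
  proof (rule that[OF h0(1,5), of K])
    fix h y g
    assume h: "0 < h" "h \<le> h0" and y: "has_density t y g" "y 0 = x"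
      and cost: "Bolza_cost L \<phi> t y \<le> ennreal (v + h\<^sup>2)"
    have h': "0 \<le> h" "h \<le> t" using h h0 by auto
    have h2: "h\<^sup>2 \<le> h" using h h0(2) by (simp add: power2_eq_square mult_left_le)
    obtain w a where wa: "0 \<le> w" "0 \<le> a" "value_function L \<phi> (t - h, y h) = ereal w"
        "action h y g = ennreal a" "w + a \<le> v + h\<^sup>2"
      using dynamic_programming_real[OF y(1) h' cost] v(2) by auto
    have "C * h \<le> 1"
    proof -
      have "(C + 1) * h \<le> (C + 1) * (1 / (C + 1))"
        using h h0(3) C(1) by (intro mult_left_mono) auto
      then show ?thesis using C(1) h(1) by (simp add: algebra_simps)
    qed
    have near: "norm (y s - x) \<le> \<mu>" if "s \<in> {0..h}" for s
    proof -
      have "k * norm (y s - y 0) \<le> a + C * h"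
        using that k(1) wa by (intro action_growth[OF y(1) h' _ _ _ C(2)]) auto
      also have "\<dots> \<le> k * \<mu>"
        using wa \<open>C * h \<le> 1\<close> h2 h h0(2) k(2) by simp
      finally show ?thesis using k(1) y(2) by simp
    qed
    define \<Delta> where "\<Delta> = y h - x"
    have \<Delta>: "norm \<Delta> \<le> d / 4"
      using near[of h] h(1) \<mu>(3) by (simp add: \<Delta>_def)
    have diff: "(t - h, y h) - (t, x) = (- h, \<Delta>)" by (simp add: \<Delta>_def)
    have nm: "norm (- h, \<Delta>) \<le> h + norm \<Delta>"
      using norm_Pair_le[of "-h" \<Delta>] h(1) by simp
    also have "\<dots> < d" using \<Delta> h h0(4) d(1) by simp
    finally have "v + (p_t, p_x) \<bullet> (- h, \<Delta>) - e * norm (- h, \<Delta>) \<le> w"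
      using d(2)[of "(t - h, y h)" w] wa(3) unfolding diff by simp
    moreover have "e * norm (- h, \<Delta>) \<le> e * (h + norm \<Delta>)"
      using nm e by (intro mult_left_mono) auto
    ultimately have a: "a \<le> h\<^sup>2 + p_t * h - p_x \<bullet> \<Delta> + e * (h + norm \<Delta>)"
      using wa(5) by simp
    have "(norm p_x + e + 1) * norm (y h - y 0) \<le> a + C2 * h"
      using h(1) e wa by (intro action_growth[OF y(1) h' _ _ _ C2(2)]) auto
    moreover have "- (p_x \<bullet> \<Delta>) \<le> norm p_x * norm \<Delta>"
      using norm_cauchy_schwarz[of "- p_x" \<Delta>] by simp
    moreover have "p_t * h \<le> \<bar>p_t\<bar> * h" using h(1) by simp
    ultimately have "norm \<Delta> \<le> K * h"
      using a h2 y(2) by (simp add: \<Delta>_def[symmetric] K_def algebra_simps)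
    with a near wa \<mu>(2) show "norm (y h - x) \<le> K * h \<and> (\<forall>s\<in>{0..h}. norm (y s - x) \<le> \<rho>) \<and>
      (\<exists>a\<ge>0. action h y g = ennreal a \<and>
        a \<le> h\<^sup>2 + p_t * h - p_x \<bullet> (y h - x) + e * (h + norm (y h - x)))"
      unfolding \<Delta>_def by (intro conjI ballI exI[of _ a]) (auto intro: order_trans)
  qed
qed

text \<open>A Hamiltonian below \<open>- p_t\<close> means that \<open>L x\<close> has an affine
  minorant of slope \<open>- p_x\<close> whose constant term exceeds \<open>p_t\<close>. Along
  near-minimizers it forces a larger action than the subgradient allows.\<close>

lemma viscosity_supersolution:
  assumes p: "(p_t, p_x) \<in> subdifferential (value_function L \<phi>) (t, x)" and t: "0 < t"
  shows "0 \<le> ereal p_t + hamiltonian L x (- p_x)"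
proof (rule ccontr)
  assume "\<not> ?thesis"
  then have "hamiltonian L x (- p_x) < ereal (- p_t)"
    by (cases "hamiltonian L x (- p_x)") auto
  then obtain c where c: "hamiltonian L x (- p_x) < ereal c" "c < - p_t"
    using ereal_dense2 by (metis less_ereal.simps(1))
  \<comment> \<open>Half of the gap \<open>\<eta>\<close> is spent on moving the base point and a
    quarter on the error of the subgradient inequality. The last quarter would have to be at most
    \<open>h\<close>, which \<open>h \<le> \<eta> / 8\<close> excludes.\<close>
  define \<eta> where "\<eta> = - p_t - c"
  have \<eta>: "0 < \<eta>" using c(2) by (simp add: \<eta>_def)
  have ceq: "- c - \<eta> / 2 = p_t + \<eta> / 2" unfolding \<eta>_def by (simp add: field_simps)
  have min: "- c + (- p_x) \<bullet> v \<le> L x v" for v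
  proof -
    have "ereal ((- p_x) \<bullet> v - L x v) \<le> hamiltonian L x (- p_x)"
      unfolding hamiltonian_def by (rule SUP_upper) simp
    with c(1) have "ereal ((- p_x) \<bullet> v - L x v) < ereal c" by (rule le_less_trans[rotated])
    then show ?thesis by simp
  qed
  obtain d where d: "0 < d" "\<And>y v. dist y x < d \<Longrightarrow> - c + (- p_x) \<bullet> v - \<eta> / 2 \<le> L y v"
    using L_affine_minorant_nearby[OF min, of "\<eta> / 2"] \<eta> by auto
  have "(t, x) \<in> effective_domain (value_function L \<phi>)"
    using p by (auto simp: subdifferential_def split: if_splits)
  then obtain v where v: "0 \<le> v" "inf_cost \<phi> t x = ennreal v"
    by (rule value_function_finite)
  obtain K h1 where K: "0 < h1" "h1 \<le> t"
    "\<And>h y g. 0 < h \<Longrightarrow> h \<le> h1 \<Longrightarrow> has_density t y g \<Longrightarrow> y 0 = x \<Longrightarrow>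
      Bolza_cost L \<phi> t y \<le> ennreal (v + h\<^sup>2) \<Longrightarrow> norm (y h - x) \<le> K * h"
    using near_minimizer_bounds[OF p t v(2,1), of 1 1] by (metis zero_less_one)
  define e where "e = \<eta> / (4 * (1 + \<bar>K\<bar>))"
  have e: "0 < e" "e * (1 + \<bar>K\<bar>) = \<eta> / 4" using \<eta> by (simp_all add: e_def field_simps)
  obtain h2 where h2: "0 < h2" "h2 \<le> t"
    "\<And>h y g. 0 < h \<Longrightarrow> h \<le> h2 \<Longrightarrow> has_density t y g \<Longrightarrow> y 0 = x \<Longrightarrow>
      Bolza_cost L \<phi> t y \<le> ennreal (v + h\<^sup>2) \<Longrightarrow>
      (\<forall>s\<in>{0..h}. norm (y s - x) \<le> d / 2) \<and>
      (\<exists>a\<ge>0. action h y g = ennreal a \<and>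
        a \<le> h\<^sup>2 + p_t * h - p_x \<bullet> (y h - x) + e * (h + norm (y h - x)))"
    using near_minimizer_bounds[OF p t v(2,1) e(1), of "d / 2"] d(1) by (metis half_gt_zero)
  define h where "h = Min {h1, h2, \<eta> / 8}"
  have h: "0 < h" "h \<le> h1" "h \<le> h2" "h \<le> \<eta> / 8" "0 \<le> h" "h \<le> t"
    using K(1,2) h2(1) \<eta> by (auto simp: h_def)
  have "inf_cost \<phi> t x < ennreal (v + h\<^sup>2)"
    using v h(1) by (simp add: ennreal_less_iff)
  then obtain y where y: "y \<in> admissible t x" "Bolza_cost L \<phi> t y < ennreal (v + h\<^sup>2)"
    unfolding inf_cost_def by (auto simp: INF_less_iff)
  obtain g where g: "has_density t y g" "y 0 = x"
    using y(1) by (rule admissible_has_density)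
  have \<Delta>: "norm (y h - x) \<le> K * h"
    using y(2) by (intro K(3)[OF h(1,2) g]) simp
  obtain a where near: "\<And>s. s \<in> {0..h} \<Longrightarrow> norm (y s - x) \<le> d / 2"
    and a: "0 \<le> a" "action h y g = ennreal a"
      "a \<le> h\<^sup>2 + p_t * h - p_x \<bullet> (y h - x) + e * (h + norm (y h - x))"
    using h2(3)[OF h(1,3) g] y(2) by (meson less_imp_le)
  have "(- c - \<eta> / 2) * h + (- p_x) \<bullet> (y h - y 0) \<le> a"
  proof (rule action_affine_minorant[OF g(1) h(5,6) _ a(1)])
    fix s u assume "0 \<le> s" "s \<le> h"
    then have "dist (y s) x < d" using near[of s] d(1) by (simp add: dist_norm)
    from d(2)[OF this, of u] show "- c - \<eta> / 2 + (- p_x) \<bullet> u \<le> L (y s) u" by simp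
  qed (simp add: a(2))
  with a(3) g(2) have "(p_t + \<eta> / 2) * h \<le> h\<^sup>2 + p_t * h + e * (h + norm (y h - x))"
    by (simp add: ceq)
  also have "e * (h + norm (y h - x)) \<le> e * ((1 + \<bar>K\<bar>) * h)"
  proof -
    have "K * h \<le> \<bar>K\<bar> * h" using h(1) by simp
    with \<Delta> show ?thesis using e(1) by (intro mult_left_mono) (auto simp: algebra_simps)
  qed
  also have "\<dots> = \<eta> / 4 * h" unfolding mult.assoc[symmetric] e(2) ..
  finally have "(\<eta> / 4) * h \<le> h * h" by (simp add: algebra_simps power2_eq_square)
  then show False using h(1,4) \<eta> by simp
qed

section \<open>Estimates for minimizers\<close>

lemma minimizer_value:
  assumes "is_minimizer L \<phi> t x y"
  shows "Bolza_cost L \<phi> t y = inf_cost \<phi> t x"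
  using assms unfolding is_minimizer_def inf_cost_def
  by (intro antisym INF_greatest INF_lower) auto

lemma minimizer_lower_derivative:
  assumes dom: "(t, x) \<in> effective_domain (value_function L \<phi>)" and t: "0 < t"
    and y: "is_minimizer L \<phi> t x y"
    and h: "filterlim h (at_right 0) sequentially" and u: "(\<lambda>i. (y (h i) - x) /\<^sub>R h i) \<longlonglongrightarrow> u"
  shows "lower_derivative (value_function L \<phi>) (t, x) (- 1, u) \<le> - ereal (L x u)"
proof (rule ereal_le_epsilon2)
  fix e :: real assume e: "0 < e"
  obtain v where v: "0 \<le> v" "inf_cost \<phi> t x = ennreal v"
    using dom by (rule value_function_finite)
  have V: "value_function L \<phi> (t, x) = ereal v"
    using t v by (simp add: value_function_inf_cost enn2ereal_ennreal)
  have "y \<in> admissible t x" using y by (simp add: is_minimizer_def)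
  then obtain g where g: "has_density t y g" "y 0 = x" by (rule admissible_has_density)
  have e3: "0 < e / 3" using e by simp
  \<comment> \<open>The error \<open>e\<close> is split in three: for the minorant at
    \<open>u\<close>, for moving the base point away from \<open>x\<close>, and for replacing
    \<open>u\<close> by the difference quotient.\<close>
  obtain c p where cp: "\<And>w. c + p \<bullet> w \<le> L x w" "L x u - e / 3 < c + p \<bullet> u"
    by (rule convex_affine_minorant[OF L_convex[of x] e3, of u]) (assumption | rule that)+
  obtain d where d: "0 < d" "\<And>\<xi> w. dist \<xi> x < d \<Longrightarrow> c + p \<bullet> w - e / 3 \<le> L \<xi> w"
    using L_affine_minorant_nearby[OF cp(1), of "e / 3"] e by auto
  have "continuous_on {0..t} y" by (rule has_density_continuous_on[OF g(1)])
  then obtain r where r: "0 < r" "\<And>s. s \<in> {0..t} \<Longrightarrow> dist s 0 < r \<Longrightarrow> dist (y s) (y 0) < d"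
    using d(1) t unfolding continuous_on_iff by (metis atLeastAtMost_iff order_refl less_imp_le)
  have small: "\<forall>\<^sub>F i in sequentially. 0 < h i \<and> h i < min t r"
  proof -
    have "\<forall>\<^sub>F s in at_right 0. s < min t r"
      using t r(1) by (intro order_tendstoD(2)[OF tendsto_ident_at]) auto
    moreover have "\<forall>\<^sub>F s::real in at_right 0. 0 < s"
      by (simp add: eventually_at_filter)
    ultimately have "\<forall>\<^sub>F s in at_right 0. 0 < s \<and> s < min t r" by eventually_elim simp
    then show ?thesis by (rule filterlim_iff[THEN iffD1, OF h, rule_format])
  qed
  have "\<forall>\<^sub>F i in sequentially. p \<bullet> u - e / 3 < p \<bullet> ((y (h i) - x) /\<^sub>R h i)"
    using e by (intro order_tendstoD(1)[of _ "p \<bullet> u"] tendsto_intros u) simp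
  with small have le: "\<forall>\<^sub>F i in sequentially.
      (value_function L \<phi> ((t, x) + h i *\<^sub>R (- 1, (y (h i) - x) /\<^sub>R h i)) - value_function L \<phi> (t, x)) / ereal (h i)
      \<le> - ereal (L x u) + ereal e"
  proof eventually_elim
    case (elim i)
    define s where "s = h i"
    have s: "0 < s" "0 \<le> s" "s \<le> t" "s < r" using elim by (auto simp: s_def)
    have z: "(t, x) + s *\<^sub>R (- 1, (y s - x) /\<^sub>R s) = (t - s, y s)"
      using s(1) by simp
    obtain w a where wa: "0 \<le> w" "0 \<le> a" "value_function L \<phi> (t - s, y s) = ereal w"
        "action s y g = ennreal a" "w + a \<le> v"
      using dynamic_programming_real[OF g(1) s(2,3), of \<phi> v] minimizer_value[OF y] v by auto
    have "(c - e / 3) * s + p \<bullet> (y s - y 0) \<le> a"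
    proof (rule action_affine_minorant[OF g(1) s(2,3) _ wa(2)])
      fix q w assume "0 \<le> q" "q \<le> s"
      then have "dist (y q) x < d" using r(2)[of q] s g(2) by (simp add: dist_real_def)
      from d(2)[OF this, of w] show "c - e / 3 + p \<bullet> w \<le> L (y q) w" by simp
    qed (simp add: wa(4))
    moreover have "p \<bullet> (y s - y 0) = (p \<bullet> ((y s - x) /\<^sub>R s)) * s"
      using s(1) g(2) by simp
    ultimately have "w - v \<le> - (c - e / 3 + p \<bullet> ((y s - x) /\<^sub>R s)) * s"
      using wa(5) by (simp add: algebra_simps)
    then have "(w - v) / s \<le> - (c - e / 3 + p \<bullet> ((y s - x) /\<^sub>R s))"
      using s(1) by (simp only: pos_divide_le_eq)
    also have "\<dots> \<le> - L x u + e"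
      using elim cp(2) by (simp add: s_def)
    finally show ?case
      unfolding s_def[symmetric] z V wa(3) using s(1) by simp
  qed
  \<comment> \<open>A lower limit over the product filter is at most any eventual upper bound along
    a sequence tending to that filter; the directions taken here lead exactly to points
    \<open>(t - h i, y (h i))\<close> of the curve.\<close>
  have "filterlim (\<lambda>i. (h i, (- 1, (y (h i) - x) /\<^sub>R h i))) (at_right 0 \<times>\<^sub>F nhds (- 1, u)) sequentially"
    using u by (intro filterlim_Pair h tendsto_Pair) auto
  then show "lower_derivative (value_function L \<phi>) (t, x) (- 1, u) \<le> - ereal (L x u) + ereal e"
    unfolding lower_derivative_def by (rule Liminf_le_of_filterlim) (use le in simp_all)
qed


text \<open>If \<open>L\<close> is bounded for slow motion near \<open>x\<close>, fast initial arcs are slowed down to speed \<open>r\<close>. The time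
  lost is regained at bounded marginal cost on a set \<open>A\<close> of positive measure where speeding up by a
  factor of 2 costs at most \<open>C\<close>; optimality then bounds the length of the fast arcs linearly in \<open>h\<close>.\<close>

lemma minimizer_displacement_bound:
  assumes dom: "(t, x) \<in> effective_domain (value_function L \<phi>)" and t: "0 < t"
    and y: "is_minimizer L \<phi> t x y"
    and r: "0 < r" and M: "0 \<le> M" "\<And>\<xi> u. \<xi> \<in> cball x r \<Longrightarrow> u \<in> cball 0 r \<Longrightarrow> L \<xi> u \<le> M"
  obtains h0 K where "0 < h0" "h0 \<le> t" "\<And>h. 0 < h \<Longrightarrow> h \<le> h0 \<Longrightarrow> norm (y h - x) \<le> K * h"
proof -
  obtain v where v: "0 \<le> v" "inf_cost \<phi> t x = ennreal v"
    using dom by (rule value_function_finite)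
  have "y \<in> admissible t x" using y by (simp add: is_minimizer_def)
  then obtain g where g: "has_density t y g" "y 0 = x" by (rule admissible_has_density)
  have cost: "action t y g + \<phi> (y t) \<le> ennreal v"
    using minimizer_value[OF y] Bolza_cost_action[OF g(1), of \<phi>] v(2) by simp
  then obtain a b where ab: "action t y g = ennreal a" "\<phi> (y t) = ennreal b" "0 \<le> a" "0 \<le> b"
    using v(1) by (rule ennreal_add_leE)
  have gi: "integrable lborel g" by (rule has_density_integrable[OF g(1)])
  then have gm [measurable]: "g \<in> borel_measurable borel" by auto
  have yc: "continuous_on {0..t} y" by (rule has_density_continuous_on[OF g(1)])
  define f where "f = (\<lambda>s. L (y s) (g s) * indicator {0..t} s)"
  have f0: "0 \<le> f s" for s by (simp add: f_def L_nonneg)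
  have fi: "integrable lborel f"
    using action_real(1)[OF yc gm, of a] ab unfolding f_def set_integrable_def by (simp add: mult.commute)
  have fa: "ennreal (integral\<^sup>L lborel f) = action t y g"
    unfolding action_eq using nn_integral_eq_integral[OF fi] f0 by (simp add: f_def)

  \<comment> \<open>\<open>L\<close> is finite, so these sets exhaust \<open>{t/2<..t}\<close> and
    one of them has positive measure. Staying in the second half of the interval keeps it away from
    the fast arcs in \<open>{0..h}\<close>.\<close>
  define A where "A = (\<lambda>n::nat. {s \<in> {t/2<..t}. L (y s) (2 *\<^sub>R g s) \<le> real n})"
  have Am: "A n \<in> sets borel" for n
  proof -
    have "(\<lambda>s. L (y s) (2 *\<^sub>R g s) * indicator {0..t} s) \<in> borel_measurable borel"
      by (rule L_curve_borel[OF yc]) measurable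
    then have "{s \<in> space borel. L (y s) (2 *\<^sub>R g s) * indicator {0..t} s \<le> real n} \<inter> {t/2<..t} \<in> sets borel"
      by measurable
    moreover have "{s \<in> space borel. L (y s) (2 *\<^sub>R g s) * indicator {0..t} s \<le> real n} \<inter> {t/2<..t} = A n"
      using t by (auto simp: A_def)
    ultimately show ?thesis by simp
  qed
  have "\<exists>n. emeasure lborel (A n) \<noteq> 0"
  proof (rule ccontr)
    assume "\<not> ?thesis"
    then have "emeasure lborel (\<Union>n. A n) = 0"
      using Am by (intro emeasure_UN_eq_0) auto
    moreover have "(\<Union>n. A n) = {t/2<..t}"
      by (auto simp: A_def real_arch_simple)
    ultimately show False using t by simp
  qed
  then obtain n where n: "emeasure lborel (A n) \<noteq> 0" by blast
  define B where "B = A n"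
  have Bm [measurable]: "B \<in> sets borel" and Bt: "B \<subseteq> {t/2<..t}"
    and BC: "\<And>s. s \<in> B \<Longrightarrow> L (y s) (2 *\<^sub>R g s) \<le> real n"
    using Am by (auto simp: B_def A_def)
  have Bfin: "emeasure lborel B < \<infinity>"
  proof -
    have "emeasure lborel B \<le> emeasure lborel {t/2<..t}" using Bt by (intro emeasure_mono) auto
    also have "\<dots> < \<infinity>" using t by simp
    finally show ?thesis .
  qed
  define m where "m = measure lborel B"
  have m: "0 < m"
    using n Bfin unfolding m_def B_def[symmetric]
    by (metis emeasure_eq_ennreal_measure ennreal_0 infinity_ennreal_def less_irrefl measure_nonneg not_less_iff_gr_or_eq order_le_less)
  have Bi: "integrable lborel (indicator B :: real \<Rightarrow> real)"
    using Bfin by simp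

  obtain d1 where d1: "0 < d1" "\<And>s. s \<in> {0..t} \<Longrightarrow> dist s 0 < d1 \<Longrightarrow> dist (y s) (y 0) < r"
    using yc r t unfolding continuous_on_iff by (metis atLeastAtMost_iff order_refl less_imp_le)
  have "continuous_on UNIV (\<lambda>s::real. LINT q:{0..s}|lborel. norm (g q))"
    using gi by (intro continuous_on_integral_Icc) auto
  then obtain d2 where d2: "0 < d2"
    "\<And>s. dist s 0 < d2 \<Longrightarrow> dist (LINT q:{0..s}|lborel. norm (g q)) (LINT q:{0..0::real}|lborel. norm (g q)) < r * m / 2"
    using r m unfolding continuous_on_iff by (metis UNIV_I half_gt_zero mult_pos_pos)
  \<comment> \<open>\<open>d1\<close> keeps \<open>y\<close> in the ball where slow motion costs at
    most \<open>M\<close>; \<open>d2\<close> makes the initial arc shorter than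
    \<open>r * m / 2\<close>, so that less than half the measure of \<open>B\<close> has to be
    regained.\<close>
  define h0 where "h0 = Min {d1, d2, t} / 2"
  have h0: "0 < h0" "h0 < d1" "h0 < d2" "h0 \<le> t / 2"
    using d1(1) d2(1) t by (auto simp: h0_def min_def)

  \<comment> \<open>Per unit of fast arc length, slowing down costs at most \<open>M / r\<close> and
    regaining the time at most \<open>real n / r\<close>. A slope larger than their sum by 1 leaves
    \<open>G\<close> itself on the left in the final comparison.\<close>
  define k where "k = (M + real n) / r + 1"
  have k: "0 \<le> k" using M(1) r by (simp add: k_def)
  obtain C where C: "0 \<le> C" "\<And>\<xi> u. k * norm u - C \<le> L \<xi> u"
    by (rule L_growth[OF k]) (assumption | rule that)+

  have "norm (y h - x) \<le> (C + r) * h" if h: "0 < h" "h \<le> h0" for h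
  proof -
    have h': "0 \<le> h" "h \<le> t" "h \<le> t / 2" using h h0 t by auto
    define S where "S = {s \<in> {0..h}. r < norm (g s)}"
    have "S = {s \<in> space borel. r < norm (g s)} \<inter> {0..h}" by (auto simp: S_def)
    then have Sm [measurable]: "S \<in> sets borel" by simp
    have SB: "s \<in> S \<Longrightarrow> s \<notin> B" for s using Bt h'(3) by (auto simp: S_def)
    have Sh: "S \<subseteq> {0..h}" by (auto simp: S_def)
    have hi: "integrable lborel (indicator {0..h} :: real \<Rightarrow> real)"
      using h(1) by (intro integrable_real_indicator) auto
    have Si: "integrable lborel (indicator S :: real \<Rightarrow> real)"
    proof (rule integrable_real_indicator)
      have "emeasure lborel S \<le> emeasure lborel {0..h}" using Sh by (intro emeasure_mono) auto
      also have "\<dots> < \<infinity>" using h(1) by simp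
      finally show "emeasure lborel S < \<infinity>" .
    qed simp
    have Sgi: "integrable lborel (\<lambda>s. indicator S s * norm (g s))"
      using integrable_mult_indicator[OF _ integrable_norm[OF gi], of S] by simp
    have Sfi: "integrable lborel (\<lambda>s. indicator S s * f s)"
      using integrable_mult_indicator[OF _ fi, of S] by simp
    have hgi: "integrable lborel (\<lambda>s. indicator {0..h} s * norm (g s))"
      using integrable_mult_indicator[OF _ integrable_norm[OF gi], of "{0..h}"] by simp
    define G where "G = (LINT s|lborel. indicator S s * norm (g s))"
    define F where "F = (LINT s|lborel. indicator S s * f s)"
    \<comment> \<open>The time lost when the fast arcs are run at speed \<open>r\<close>.\<close>
    define e where "e = (LINT s|lborel. indicator S s * (norm (g s) / r - 1))"
    have ei: "integrable lborel (\<lambda>s. indicator S s * (norm (g s) / r - 1))"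
    proof -
      have "(\<lambda>s. indicator S s * (norm (g s) / r - 1)) = (\<lambda>s. (indicator S s * norm (g s)) / r - indicator S s)"
        by (auto simp: algebra_simps)
      then show ?thesis using Sgi Si by simp
    qed
    have e0: "0 \<le> e"
      unfolding e_def using r by (intro integral_nonneg_AE AE_I2) (auto simp: indicator_def S_def)
    have eG: "e \<le> G / r"
    proof -
      have "e \<le> (LINT s|lborel. (indicator S s * norm (g s)) / r)"
        unfolding e_def using ei Sgi r by (intro integral_mono) (auto simp: indicator_def)
      then show ?thesis by (simp add: G_def)
    qed
    have "G \<le> (LINT s|lborel. indicator {0..h} s * norm (g s))"
      unfolding G_def using Sgi hgi Sh by (intro integral_mono) (auto simp: indicator_def)
    also have "\<dots> < r * m / 2"
      using d2(2)[of h] h h0 lborel_integral_singleton[of 0 "\<lambda>q. norm (g q)"]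
      by (simp add: dist_real_def set_lebesgue_integral_def)
    finally have "G / r < m / 2"
      using r by (simp add: pos_divide_less_eq mult.commute)
    with eG have "e < m / 2" by (rule le_less_trans)
    define \<eta> where "\<eta> = e / m"
    have \<eta>: "0 \<le> \<eta>" "\<eta> < 1 / 2" "\<eta> * m = e"
      using e0 m \<open>e < m / 2\<close> by (simp_all add: \<eta>_def field_simps)
    \<comment> \<open>On \<open>S\<close> the new speed is exactly \<open>r\<close>; on
      \<open>B\<close> time is compressed by the factor \<open>1 - \<eta>\<close>, and
      \<open>\<eta> * m = e\<close> restores the total duration.\<close>
    define w where "w = (\<lambda>s. 1 + indicator S s * (norm (g s) / r - 1) - \<eta> * indicator B s)"
    have wS: "w s = norm (g s) / r" if "s \<in> S" for s
      using that SB[OF that] by (simp add: w_def)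
    have wB: "w s = 1 - \<eta>" if "s \<in> B" for s
      using that SB[of s] by (auto simp: w_def indicator_def)
    have w1: "w s = 1" if "s \<notin> S" "s \<notin> B" for s
      using that by (simp add: w_def)
    have wm: "w \<in> borel_measurable borel"
      unfolding w_def by measurable
    have wge: "1 / 2 \<le> w s" for s
    proof -
      have "1 < norm (g s) / r" if "s \<in> S" using that r by (simp add: S_def)
      then show ?thesis using wS[of s] wB[of s] w1[of s] \<eta> by fastforce
    qed
    have w1i: "integrable lborel (\<lambda>s. w s - 1)"
      unfolding w_def using ei Bi by simp
    have w1z: "(LINT s|lborel. w s - 1) = 0"
      unfolding w_def using ei Bi \<eta>(3) by (simp add: e_def m_def)
    have wout: "w s = 1" if "s \<notin> {0..t}" for s
      using that Sh Bt h' t by (intro w1) auto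
    obtain z where z: "z \<in> admissible t x"
      "Bolza_cost L \<phi> t z = (\<integral>\<^sup>+ s\<in>{0..t}. ennreal (w s * L (y s) (g s /\<^sub>R w s)) \<partial>lborel) + \<phi> (y t)"
      by (rule reparametrization[OF g(1) less_imp_le[OF t] wm _ wge w1i wout w1z, unfolded g(2)])
        (assumption | simp | rule that)+
    \<comment> \<open>A majorant of the new integrand: on \<open>S\<close> the old cost is replaced
      by \<open>M\<close> times the new time element, on \<open>B\<close> the surcharge for
      acceleration is added.\<close>
    define R where "R = (\<lambda>s. f s + (M / r * (indicator S s * norm (g s)) - indicator S s * f s) + \<eta> * real n * indicator B s)"
    have R0: "0 \<le> R s" for s
    proof -
      have "0 \<le> f s + (M / r * (indicator S s * norm (g s)) - indicator S s * f s)"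
        using f0[of s] M(1) r by (simp add: indicator_def)
      then show ?thesis using \<eta>(1) by (simp add: R_def)
    qed
    have Ri: "integrable lborel R"
      unfolding R_def using fi Sgi Sfi Bi by simp
    have Rint: "integral\<^sup>L lborel R = integral\<^sup>L lborel f + (M / r * G - F) + real n * e"
      unfolding R_def G_def F_def using fi Sgi Sfi Bi \<eta>(3) by (simp add: m_def mult.commute mult.left_commute)
    have le: "w s * L (y s) (g s /\<^sub>R w s) \<le> R s" if s: "s \<in> {0..t}" for s
    proof -
      consider "s \<in> S" | "s \<in> B" "s \<notin> S" | "s \<notin> S" "s \<notin> B" by blast
      then show ?thesis
      proof cases
        case 1
        then have n0: "0 < norm (g s)" using r by (auto simp: S_def)
        have "dist (y s) (y 0) < r"
          using 1 s h h0 Sh by (intro d1(2)) auto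
        then have "y s \<in> cball x r" by (simp add: g(2) dist_commute)
        moreover have "g s /\<^sub>R w s \<in> cball 0 r"
          using r n0 by (simp add: wS[OF 1] field_simps)
        ultimately have "L (y s) (g s /\<^sub>R w s) \<le> M" by (rule M(2))
        then have "w s * L (y s) (g s /\<^sub>R w s) \<le> w s * M"
          using wge[of s] by (intro mult_left_mono) auto
        then show ?thesis using 1 SB[OF 1] by (simp add: R_def wS mult.commute)
      next
        case 2
        have \<eta>1: "0 < 1 - \<eta>" using \<eta> by simp
        \<comment> \<open>The accelerated velocity lies between \<open>g s\<close> and its double;
          \<open>\<eta> < 1 / 2\<close> makes the first weight positive.\<close>
        have comb: "g s /\<^sub>R (1 - \<eta>) = ((1 - 2 * \<eta>) / (1 - \<eta>)) *\<^sub>R g s + (\<eta> / (1 - \<eta>)) *\<^sub>R (2 *\<^sub>R g s)"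
        proof -
          have "(1 - 2 * \<eta>) / (1 - \<eta>) + \<eta> / (1 - \<eta>) * 2 = inverse (1 - \<eta>)"
            using \<eta>1 by (simp add: field_simps)
          then show ?thesis by (simp flip: scaleR_add_left)
        qed
        have "L (y s) (g s /\<^sub>R (1 - \<eta>)) \<le> (1 - 2 * \<eta>) / (1 - \<eta>) * L (y s) (g s) + \<eta> / (1 - \<eta>) * L (y s) (2 *\<^sub>R g s)"
          unfolding comb
        proof (rule L_convex[unfolded convex_on_def, THEN conjunct2, rule_format, OF UNIV_I UNIV_I])
          show "(1 - 2 * \<eta>) / (1 - \<eta>) + \<eta> / (1 - \<eta>) = 1"
            using \<eta>1 by (simp flip: add_divide_distrib)
        qed (use \<eta> in auto)
        then have "(1 - \<eta>) * L (y s) (g s /\<^sub>R (1 - \<eta>)) \<le> (1 - \<eta>) * ((1 - 2 * \<eta>) / (1 - \<eta>) * L (y s) (g s) + \<eta> / (1 - \<eta>) * L (y s) (2 *\<^sub>R g s))"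
          using \<eta>1 by (intro mult_left_mono) auto
        also have "\<dots> = (1 - 2 * \<eta>) * L (y s) (g s) + \<eta> * L (y s) (2 *\<^sub>R g s)"
          using \<eta>1 by (simp add: distrib_left)
        also have "\<dots> \<le> L (y s) (g s) + \<eta> * real n"
        proof -
          have "(1 - 2 * \<eta>) * L (y s) (g s) \<le> L (y s) (g s)"
            using \<eta>(1) L_nonneg[of "y s" "g s"] by (simp add: algebra_simps)
          moreover have "\<eta> * L (y s) (2 *\<^sub>R g s) \<le> \<eta> * real n"
            using \<eta>(1) BC[OF 2(1)] by (rule mult_left_mono[rotated])
          ultimately show ?thesis by simp
        qed
        finally show ?thesis using 2 s by (simp add: R_def wB f_def)
      next
        case 3
        then show ?thesis using s by (simp add: R_def w1 f_def)
      qed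
    qed
    have "action t y g + \<phi> (y t) \<le> (\<integral>\<^sup>+ s\<in>{0..t}. ennreal (w s * L (y s) (g s /\<^sub>R w s)) \<partial>lborel) + \<phi> (y t)"
      using y z Bolza_cost_action[OF g(1), of \<phi>] unfolding is_minimizer_def by metis
    \<comment> \<open>The terminal cost \<open>\<phi> (y t)\<close> is finite, so it can be
      cancelled.\<close>
    then have "action t y g \<le> (\<integral>\<^sup>+ s\<in>{0..t}. ennreal (w s * L (y s) (g s /\<^sub>R w s)) \<partial>lborel)"
      unfolding ab(2) by (simp add: ennreal_add_left_cancel_le add.commute[of _ "ennreal b"])
    also have "\<dots> \<le> (\<integral>\<^sup>+ s. ennreal (R s) \<partial>lborel)"
      using le by (intro nn_integral_mono) (auto simp: indicator_def intro!: ennreal_leI)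
    also have "\<dots> = ennreal (integral\<^sup>L lborel R)"
      using R0 by (intro nn_integral_eq_integral[OF Ri] AE_I2)
    finally have "ennreal (integral\<^sup>L lborel f) \<le> ennreal (integral\<^sup>L lborel R)"
      by (simp only: fa)
    moreover have "0 \<le> integral\<^sup>L lborel R"
      using R0 by (intro integral_nonneg_AE AE_I2)
    ultimately have "integral\<^sup>L lborel f \<le> integral\<^sup>L lborel R" by simp
    then have "F \<le> M / r * G + real n * e" unfolding Rint by simp
    also have "\<dots> \<le> M / r * G + real n * (G / r)"
      using eG by (intro add_left_mono mult_left_mono) auto
    also have "\<dots> = (k - 1) * G" by (simp add: k_def algebra_simps add_divide_distrib)
    finally have FG: "F \<le> (k - 1) * G" .
    have "k * G - C * h \<le> F"
    proof -
      have "k * G - C * h = (LINT s|lborel. k * (indicator S s * norm (g s)) - C * indicator {0..h} s)"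
        using Sgi hi h(1) by (simp add: G_def)
      also have "\<dots> \<le> F"
        unfolding F_def
      proof (rule integral_mono)
        show "k * (indicator S s * norm (g s)) - C * indicator {0..h} s \<le> indicator S s * f s" for s
          using C(1) C(2)[of "g s" "y s"] Sh h' by (auto simp: indicator_def f_def)
      qed (use Sgi hi Sfi in auto)
      finally show ?thesis .
    qed
    with FG have GC: "G \<le> C * h" by (simp add: algebra_simps)
    have "norm (y h - x) \<le> (LINT s|lborel. indicator {0..h} s * norm (g s))"
      using has_density_displacement[OF g(1) h'(1) order_refl h'(2)] g(2) by (simp add: set_lebesgue_integral_def)
    \<comment> \<open>Off \<open>S\<close> the speed is at most \<open>r\<close>, so those arcs add
      no more than \<open>r * h\<close>.\<close>
    also have "\<dots> \<le> (LINT s|lborel. indicator S s * norm (g s) + r * indicator {0..h} s)"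
    proof (rule integral_mono[OF hgi])
      show "integrable lborel (\<lambda>s. indicator S s * norm (g s) + r * indicator {0..h} s)"
        using Sgi hi by simp
    qed (use r in \<open>auto simp: indicator_def S_def\<close>)
    also have "\<dots> = G + r * h"
      using Sgi hi h(1) by (simp add: G_def)
    also have "\<dots> \<le> (C + r) * h" using GC by (simp add: algebra_simps)
    finally show ?thesis .
  qed
  then show thesis
    using h0 t by (intro that[of h0 "C + r"]) auto
qed

end

theorem proposition3p2:
  fixes L :: "real ^ 'n \<Rightarrow> real ^ 'n \<Rightarrow> real"
    and \<phi> :: "real ^ 'n \<Rightarrow> ennreal"
    and \<Theta> :: "real ^ 'n \<Rightarrow> real"
  assumes L_nonneg: "\<And>x u. 0 \<le> L x u"
    and L_lsc: "lsc (\<lambda>(x, u). ereal (L x u))"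
    and L_convex: "\<And>x. convex_on UNIV (L x)"
    and Theta_nonneg: "\<And>u. 0 \<le> \<Theta> u"
    and Theta_convex: "convex_on UNIV \<Theta>"
    and Theta_superlinear: "filterlim (\<lambda>u. \<Theta> u / norm u) at_top at_infinity"
    and L_ge_Theta: "\<And>x u. \<Theta> u \<le> L x u"
    and phi_lsc: "lsc \<phi>"
    and phi_proper: "\<exists>x. \<phi> x \<noteq> \<infinity>"
  shows "(\<forall>t x y. (t, x) \<in> effective_domain (value_function L \<phi>) \<and> 0 < t \<and> is_minimizer L \<phi> t x y \<and>
            (subdifferential (value_function L \<phi>) (t, x) \<noteq> {} \<or>
             (\<forall>x0. \<exists>M>0. \<exists>r>0. \<forall>(\<xi>, u) \<in> cball x0 r \<times> cball 0 r. L \<xi> u \<le> M)) \<longrightarrow>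
            bounded {(y h - x) /\<^sub>R h | h. 0 < h \<and> h \<le> t} \<and>
            (\<forall>(h :: nat \<Rightarrow> real) u.
               filterlim h (at_right 0) sequentially \<and>
               (\<lambda>i. (y (h i) - x) /\<^sub>R h i) \<longlonglongrightarrow> u \<longrightarrow>
               lower_derivative (value_function L \<phi>) (t, x) (- 1, u) \<le> - ereal (L x u))) \<and>
         (\<forall>t x p_t p_x. 0 < t \<and> (p_t, p_x) \<in> subdifferential (value_function L \<phi>) (t, x) \<longrightarrow>
            ereal p_t + hamiltonian L x (- p_x) \<ge> 0)"
proof -
  interpret lagrangian L \<Theta>
    using L_nonneg L_lsc L_convex Theta_superlinear L_ge_Theta by unfold_locales
  show ?thesis
  proof (intro conjI allI impI; (elim conjE)?)
    fix t x y
    assume dom: "(t, x) \<in> effective_domain (value_function L \<phi>)" and t: "0 < t"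
      and y: "is_minimizer L \<phi> t x y"
      and alt: "subdifferential (value_function L \<phi>) (t, x) \<noteq> {} \<or>
             (\<forall>x0. \<exists>M>0. \<exists>r>0. \<forall>(\<xi>, u) \<in> cball x0 r \<times> cball 0 r. L \<xi> u \<le> M)"
    have "y \<in> admissible t x" using y by (simp add: is_minimizer_def)
    then obtain g where g: "has_density t y g" "y 0 = x" by (rule admissible_has_density)
    have "\<exists>h0>0. \<exists>K. \<forall>h. 0 < h \<and> h \<le> h0 \<longrightarrow> norm (y h - x) \<le> K * h"
      using alt
    proof
      assume "subdifferential (value_function L \<phi>) (t, x) \<noteq> {}"
      then obtain p_t p_x where p: "(p_t, p_x) \<in> subdifferential (value_function L \<phi>) (t, x)"
        by auto
      obtain v where v: "0 \<le> v" "inf_cost \<phi> t x = ennreal v"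
        using dom by (rule value_function_finite)
      \<comment> \<open>A minimizer is an \<open>h\<^sup>2\<close>-minimizer for every
        \<open>h\<close> at once, so the single curve \<open>y\<close> serves all small
        \<open>h\<close>.\<close>
      have cost: "Bolza_cost L \<phi> t y \<le> ennreal (v + h\<^sup>2)" for h
        unfolding minimizer_value[OF y] v(2) by (rule ennreal_leI) simp
      obtain h0 K where K: "0 < h0"
        "\<And>h y g. 0 < h \<Longrightarrow> h \<le> h0 \<Longrightarrow> has_density t y g \<Longrightarrow> y 0 = x \<Longrightarrow>
          Bolza_cost L \<phi> t y \<le> ennreal (v + h\<^sup>2) \<Longrightarrow> norm (y h - x) \<le> K * h"
        using near_minimizer_bounds[OF p t v(2,1), of 1 1] by (metis zero_less_one)
      show ?thesis
        using K(1) K(2)[OF _ _ g cost] by (intro exI[of _ h0] exI[of _ K] conjI) simp_all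
    next
      assume "\<forall>x0. \<exists>M>0. \<exists>r>0. \<forall>(\<xi>, u) \<in> cball x0 r \<times> cball 0 r. L \<xi> u \<le> M"
      then obtain M r where M: "0 < M" "0 < r" and "\<forall>(\<xi>, u) \<in> cball x r \<times> cball 0 r. L \<xi> u \<le> M"
        by meson
      then have "L \<xi> u \<le> M" if "\<xi> \<in> cball x r" "u \<in> cball 0 r" for \<xi> u
        using that by auto
      then obtain h0 K where "0 < h0" "\<And>h. 0 < h \<Longrightarrow> h \<le> h0 \<Longrightarrow> norm (y h - x) \<le> K * h"
        using minimizer_displacement_bound[OF dom t y M(2) less_imp_le[OF M(1)]] by metis
      then show ?thesis
        by (intro exI[of _ h0] exI[of _ K] conjI) simp_all
    qed
    then obtain h0 K where "0 < h0" "\<And>h. 0 < h \<Longrightarrow> h \<le> h0 \<Longrightarrow> norm (y h - x) \<le> K * h"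
      by metis
    then show "bounded {(y h - x) /\<^sub>R h | h. 0 < h \<and> h \<le> t}"
      by (rule bounded_difference_quotients[OF has_density_continuous_on[OF g(1)]])
  next
    fix t x y and h :: "nat \<Rightarrow> real" and u
    assume "(t, x) \<in> effective_domain (value_function L \<phi>)" "0 < t" "is_minimizer L \<phi> t x y"
      "filterlim h (at_right 0) sequentially" "(\<lambda>i. (y (h i) - x) /\<^sub>R h i) \<longlonglongrightarrow> u"
    then show "lower_derivative (value_function L \<phi>) (t, x) (- 1, u) \<le> - ereal (L x u)"
      by (rule minimizer_lower_derivative)
  next
    fix t x p_t p_x
    assume "0 < t" "(p_t, p_x) \<in> subdifferential (value_function L \<phi>) (t, x)"
    then show "0 \<le> ereal p_t + hamiltonian L x (- p_x)"
      by (intro viscosity_supersolution)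
  qed
qed

end
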